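(* Let $m:(0,\infty)\to(0,\infty)$ be a positive continuous function and let the observation operator $Q\in\mathcal{L}(H_{1/2},Y)$ be $m(\lambda)$-bounded. Then there exist a sequence of real numbers $\lambda_k\to\infty$ and a constant $C>0$ such that for all $k$ $$\|(\mathcal{A}+i\lambda_k)^{-1}\|_{\mathcal{L}(\mathcal{H})}\ge\frac{1}{C\,m(|\lambda_k|)}.$$
   Context: Setting. $H=H_0$ is an infinite-dimensional complex Hilbert space, $P:H_1\to H$ is a nonnegative self-adjoint operator with compact resolvent and dense domain $H_1\subset H$. Write $Pu=\int_0^\infty\rho^2\,dE_\rho(u)$ and $f(P)u=\int_0^\infty f(\rho^2)\,dE_\rho(u)$ for its spectral resolution and Borel functional calculus. For $s\in\mathbb{R}$ set $\Lambda^s=(1+P)^s$ and $H_s=\Lambda^{-s}(H)$ with norm $\|\Lambda^s\cdot\|_H$; for $s>0$, $H_{-s}$ is identified with the dual of $H_s$ with respect to the pivot space $H$. Thus $P$ extends to a bounded operator $H_{1/2}\to H_{-1/2}$. $Y$ is a Hilbert space (the observation space), $Q\in\mathcal{L}(H_{1/2},Y)$ and $Q^*\in\mathcal{L}(Y,H_{-1/2})$ is its adjoint, so $Q^*Q\in\mathcal{L}(H_{1/2},H_{-1/2})$. The damped wave generator is $\mathcal{A}=\begin{pmatrix}0&1\\-P&-Q^*Q\end{pmatrix}$ with domain $\{(u,v)\in H_{1/2}\times H_{1/2}:\ Pu+Q^*Qv\in H\}$, on $\mathcal{H}=H_{1/2}\times H$; it generates a strongly continuous semigroup on $\mathcal{H}$.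 Definition ($m$-boundedness). Let $m$ be a positive continuous function on $(0,\infty)$. $Q:H_{1/2}\to Y$ is $m(\lambda)$-bounded if for some $\chi\in C^0([0,\infty))$ with $\chi(1)>0$ there is $C>0$ such that $$\|(1+\lambda^{-2}P)^{-1/2}Q^*Q\,\chi(\lambda^{-2}P)u\|_H\le C\,m(\lambda)\,\|(1+\lambda^{-2}P)^{1/2}u\|_H$$ for all $u\in H_{1/2}$ and all real $\lambda\ge C$. Convention: the norm of $(\mathcal{A}+i\lambda)^{-1}$ is $+\infty$ if $\mathcal{A}+i\lambda$ is not boundedly invertible on $\mathcal{H}$. *)

theory Defs
  imports "HOL-Analysis.Analysis"
begin

section \<open>Complex Hilbert spaces\<close>

text \<open>The inner product is linear in the first and antilinear in the second argument. The norm,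
  the metric and completeness are those of the underlying real Banach space.\<close>

class complex_hilbert = banach +
  fixes scaleC :: "complex \<Rightarrow> 'a \<Rightarrow> 'a" (infixr "*\<^sub>C" 75)
    and cinner :: "'a \<Rightarrow> 'a \<Rightarrow> complex"
  assumes scaleC_add_right: "a *\<^sub>C (x + y) = a *\<^sub>C x + a *\<^sub>C y"
    and scaleC_add_left: "(a + b) *\<^sub>C x = a *\<^sub>C x + b *\<^sub>C x"
    and scaleC_scaleC: "a *\<^sub>C b *\<^sub>C x = (a * b) *\<^sub>C x"
    and scaleC_of_real: "complex_of_real r *\<^sub>C x = r *\<^sub>R x"
    and cinner_add_left: "cinner (x + y) z = cinner x z + cinner y z"
    and cinner_scaleC_left: "cinner (a *\<^sub>C x) y = a * cinner x y"
    and cinner_commute: "cinner x y = cnj (cinner y x)"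
    and cinner_self: "cinner x x = complex_of_real ((norm x)\<^sup>2)"

global_interpretation complex_vector:
  vector_space "scaleC :: complex \<Rightarrow> 'a \<Rightarrow> 'a::complex_hilbert"
proof
  show "1 *\<^sub>C x = x" for x :: 'a
    using scaleC_of_real[of 1 x] by simp
qed (simp_all add: scaleC_add_right scaleC_add_left scaleC_scaleC)

definition infinite_dimensional :: "'a::complex_hilbert itself \<Rightarrow> bool" where
  "infinite_dimensional _ \<longleftrightarrow>
     (\<forall>B :: 'a set. finite B \<longrightarrow> complex_vector.span B \<noteq> UNIV)"

definition clinear_on ::
    "'a::complex_hilbert set \<Rightarrow> ('a \<Rightarrow> 'b::complex_hilbert) \<Rightarrow> bool" where
  "clinear_on S T \<longleftrightarrow> complex_vector.subspace S \<and>
     (\<forall>x\<in>S. \<forall>y\<in>S. T (x + y) = T x + T y) \<and> (\<forall>a. \<forall>x\<in>S. T (a *\<^sub>C x) = a *\<^sub>C T x)"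


section \<open>Unbounded operators\<close>

text \<open>An unbounded operator is a pair of a domain \<open>D\<close> and a function whose values outside
  \<open>D\<close> are irrelevant.\<close>

text \<open>The second conjunct says that the graph of the adjoint is the graph of the operator.\<close>

definition self_adjoint :: "'a::complex_hilbert set \<Rightarrow> ('a \<Rightarrow> 'a) \<Rightarrow> bool" where
  "self_adjoint D P \<longleftrightarrow> clinear_on D P \<and> closure D = UNIV \<and>
     (\<forall>v w. (\<forall>u\<in>D. cinner (P u) v = cinner u w) \<longleftrightarrow> v \<in> D \<and> w = P v)"

definition nonnegative_operator :: "'a::complex_hilbert set \<Rightarrow> ('a \<Rightarrow> 'a) \<Rightarrow> bool" where
  "nonnegative_operator D P \<longleftrightarrow> (\<forall>u\<in>D. 0 \<le> Re (cinner (P u) u))"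

definition compact_resolvent :: "'a::complex_hilbert set \<Rightarrow> ('a \<Rightarrow> 'a) \<Rightarrow> bool" where
  "compact_resolvent D P \<longleftrightarrow> (\<exists>z. bij_betw (\<lambda>u. P u - z *\<^sub>C u) D UNIV \<and>
     (\<forall>S. bounded S \<longrightarrow> compact (closure (inv_into D (\<lambda>u. P u - z *\<^sub>C u) ` S))))"


section \<open>Spectral resolution and Borel functional calculus\<close>

text \<open>Right-continuous resolutions of the identity \<open>E\<close>, supported on the half-line from \<open>0\<close>;
  the jump of \<open>E\<close> at \<open>0\<close> is the projection onto the kernel.\<close>

definition spectral_family :: "(real \<Rightarrow> 'a::complex_hilbert \<Rightarrow> 'a) \<Rightarrow> bool" where
  "spectral_family E \<longleftrightarrow>
     (\<forall>r. clinear_on UNIV (E r)) \<and>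
     (\<forall>r u v. cinner (E r u) v = cinner u (E r v)) \<and>
     (\<forall>r s u. E r (E s u) = E (min r s) u) \<and>
     (\<forall>r u. ((\<lambda>s. E s u) \<longlongrightarrow> E r u) (at_right r)) \<and>
     (\<forall>r<0. \<forall>u. E r u = 0) \<and>
     (\<forall>u. ((\<lambda>r. E r u) \<longlongrightarrow> u) at_top)"

text \<open>The Lebesgue--Stieltjes measure \<open>d\<parallel>E\<^sub>\<rho> u\<parallel>\<^sup>2\<close>.\<close>

definition spectral_measure :: "(real \<Rightarrow> 'a::complex_hilbert \<Rightarrow> 'a) \<Rightarrow> 'a \<Rightarrow> real measure" where
  "spectral_measure E u = interval_measure (\<lambda>r. (norm (E r u))\<^sup>2)"

text \<open>\<open>\<integral> f(\<rho>\<^sup>2) d\<langle>E\<^sub>\<rho> u, v\<rangle>\<close>, where the complex measure is given by polarization.\<close>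

definition spectral_integral ::
    "(real \<Rightarrow> 'a::complex_hilbert \<Rightarrow> 'a) \<Rightarrow> (real \<Rightarrow> real) \<Rightarrow> 'a \<Rightarrow> 'a \<Rightarrow> complex" where
  "spectral_integral E f u v =
     (\<Sum>k<4. \<i> ^ k *
        complex_of_real (\<integral>r. f (r\<^sup>2) \<partial>spectral_measure E (u + \<i> ^ k *\<^sub>C v))) / 4"

definition fdom :: "(real \<Rightarrow> 'a::complex_hilbert \<Rightarrow> 'a) \<Rightarrow> (real \<Rightarrow> real) \<Rightarrow> 'a set" where
  "fdom E f = {u. (\<lambda>r. f (r\<^sup>2)) \<in> borel_measurable borel \<and>
     integrable (spectral_measure E u) (\<lambda>r. (f (r\<^sup>2))\<^sup>2)}"

text \<open>\<open>f(P) u = \<integral> f(\<rho>\<^sup>2) dE\<^sub>\<rho>(u)\<close>, meaningful for \<open>u\<close> in the domain of \<open>f(P)\<close>. The integral is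
  taken weakly, tested on the (dense) domain, where all the scalar integrals converge.\<close>

definition fcalc :: "(real \<Rightarrow> 'a::complex_hilbert \<Rightarrow> 'a) \<Rightarrow> (real \<Rightarrow> real) \<Rightarrow> 'a \<Rightarrow> 'a" where
  "fcalc E f u = (THE w. \<forall>v\<in>fdom E f. cinner w v = spectral_integral E f u v)"

definition spectral_resolution ::
    "'a::complex_hilbert set \<Rightarrow> ('a \<Rightarrow> 'a) \<Rightarrow> (real \<Rightarrow> 'a \<Rightarrow> 'a) \<Rightarrow> bool" where
  "spectral_resolution D P E \<longleftrightarrow> spectral_family E \<and>
     D = fdom E (\<lambda>x. x) \<and> (\<forall>u\<in>D. P u = fcalc E (\<lambda>x. x) u)"


section \<open>The scale of spaces\<close>

text \<open>\<open>H\<^sub>s\<close> is realised as a subset of \<open>H\<close> for \<open>s \<ge> 0\<close> only.\<close>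

definition sobolev :: "(real \<Rightarrow> 'a::complex_hilbert \<Rightarrow> 'a) \<Rightarrow> real \<Rightarrow> 'a set" where
  "sobolev E s = range (fcalc E (\<lambda>x. (1 + x) powr (- s)))"

definition sobolev_norm :: "(real \<Rightarrow> 'a::complex_hilbert \<Rightarrow> 'a) \<Rightarrow> real \<Rightarrow> 'a \<Rightarrow> real" where
  "sobolev_norm E s u = norm (fcalc E (\<lambda>x. (1 + x) powr s) u)"

abbreviation H_half :: "(real \<Rightarrow> 'a::complex_hilbert \<Rightarrow> 'a) \<Rightarrow> 'a set" where
  "H_half E \<equiv> sobolev E (1/2)"

text \<open>Elements of \<open>H\<^sub>-\<^sub>1\<^sub>/\<^sub>2\<close> are antilinear functionals on \<open>H\<^sub>1\<^sub>/\<^sub>2\<close>, written as functions on \<open>H\<close> whose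
  values outside \<open>H\<^sub>1\<^sub>/\<^sub>2\<close> are irrelevant. The pivot embedding, which is complex-linear, sends \<open>h \<in> H\<close>
  to \<open>w \<mapsto> \<langle>h, w\<rangle>\<close>.\<close>

definition represents ::
    "(real \<Rightarrow> 'a::complex_hilbert \<Rightarrow> 'a) \<Rightarrow> ('a \<Rightarrow> complex) \<Rightarrow> 'a \<Rightarrow> bool" where
  "represents E F h \<longleftrightarrow> (\<forall>w\<in>H_half E. F w = cinner h w)"

text \<open>The extension of \<open>P\<close> to an operator from \<open>H\<^sub>1\<^sub>/\<^sub>2\<close> to \<open>H\<^sub>-\<^sub>1\<^sub>/\<^sub>2\<close>:
  \<open>\<langle>P u, w\<rangle> = \<integral> \<rho>\<^sup>2 d\<langle>E\<^sub>\<rho> u, w\<rangle>\<close>.\<close>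

definition P_ext :: "(real \<Rightarrow> 'a::complex_hilbert \<Rightarrow> 'a) \<Rightarrow> 'a \<Rightarrow> 'a \<Rightarrow> complex" where
  "P_ext E u = (\<lambda>w. spectral_integral E (\<lambda>x. x) u w)"

text \<open>For bounded \<open>f\<close> such that \<open>f(P)\<close> maps \<open>H\<close> to \<open>H\<^sub>1\<^sub>/\<^sub>2\<close>, the extension of \<open>f(P)\<close> to an operator
  from \<open>H\<^sub>-\<^sub>1\<^sub>/\<^sub>2\<close> to \<open>H\<close> by duality: \<open>\<langle>f(P) F, v\<rangle> = \<langle>F, f(P) v\<rangle>\<close>.\<close>

definition fcalc_dual ::
    "(real \<Rightarrow> 'a::complex_hilbert \<Rightarrow> 'a) \<Rightarrow> (real \<Rightarrow> real) \<Rightarrow> ('a \<Rightarrow> complex) \<Rightarrow> 'a" where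
  "fcalc_dual E f F = (THE h. \<forall>v. cinner h v = F (fcalc E f v))"


section \<open>The observation operator\<close>

definition bounded_observation ::
    "(real \<Rightarrow> 'a::complex_hilbert \<Rightarrow> 'a) \<Rightarrow> ('a \<Rightarrow> 'b::complex_hilbert) \<Rightarrow> bool" where
  "bounded_observation E Q \<longleftrightarrow> clinear_on (H_half E) Q \<and>
     (\<exists>K. \<forall>u\<in>H_half E. norm (Q u) \<le> K * sobolev_norm E (1/2) u)"

text \<open>The adjoint of \<open>Q\<close> maps \<open>Y\<close> to \<open>H\<^sub>-\<^sub>1\<^sub>/\<^sub>2\<close>.\<close>

definition Q_adj :: "('a::complex_hilbert \<Rightarrow> 'b::complex_hilbert) \<Rightarrow> 'b \<Rightarrow> 'a \<Rightarrow> complex" where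
  "Q_adj Q y = (\<lambda>w. cinner y (Q w))"

text \<open>The inequality is understood to include that its left-hand side makes sense, i.e. that
  \<open>\<chi>(\<lambda>\<^sup>-\<^sup>2 P) u\<close> is defined and lies in the domain \<open>H\<^sub>1\<^sub>/\<^sub>2\<close> of \<open>Q\<close> (this is not automatic, since
  \<open>\<chi>\<close> need not be bounded).\<close>

definition m_bounded ::
    "(real \<Rightarrow> 'a::complex_hilbert \<Rightarrow> 'a) \<Rightarrow> ('a \<Rightarrow> 'b::complex_hilbert) \<Rightarrow> (real \<Rightarrow> real) \<Rightarrow> bool" where
  "m_bounded E Q m \<longleftrightarrow>
     (\<exists>chi :: real \<Rightarrow> real. continuous_on {0..} chi \<and> chi 1 > 0 \<and>
       (\<exists>C>0. \<forall>u\<in>H_half E. \<forall>l\<ge>C.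
          u \<in> fdom E (\<lambda>x. chi (x / l\<^sup>2)) \<and> fcalc E (\<lambda>x. chi (x / l\<^sup>2)) u \<in> H_half E \<and>
          norm (fcalc_dual E (\<lambda>x. (1 + x / l\<^sup>2) powr (-1/2))
                  (Q_adj Q (Q (fcalc E (\<lambda>x. chi (x / l\<^sup>2)) u))))
            \<le> C * m l * norm (fcalc E (\<lambda>x. (1 + x / l\<^sup>2) powr (1/2)) u)))"


section \<open>The damped wave generator and its resolvent\<close>

definition energy_space :: "(real \<Rightarrow> 'a::complex_hilbert \<Rightarrow> 'a) \<Rightarrow> ('a \<times> 'a) set" where
  "energy_space E = H_half E \<times> UNIV"

definition energy_norm :: "(real \<Rightarrow> 'a::complex_hilbert \<Rightarrow> 'a) \<Rightarrow> 'a \<times> 'a \<Rightarrow> real" where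
  "energy_norm E U = sqrt ((sobolev_norm E (1/2) (fst U))\<^sup>2 + (norm (snd U))\<^sup>2)"

definition generator_dom ::
    "(real \<Rightarrow> 'a::complex_hilbert \<Rightarrow> 'a) \<Rightarrow> ('a \<Rightarrow> 'b::complex_hilbert) \<Rightarrow> ('a \<times> 'a) set" where
  "generator_dom E Q = {(u, v). u \<in> H_half E \<and> v \<in> H_half E \<and>
     (\<exists>h. represents E (\<lambda>w. P_ext E u w + Q_adj Q (Q v) w) h)}"

definition generator ::
    "(real \<Rightarrow> 'a::complex_hilbert \<Rightarrow> 'a) \<Rightarrow> ('a \<Rightarrow> 'b::complex_hilbert) \<Rightarrow> 'a \<times> 'a \<Rightarrow> 'a \<times> 'a" where
  "generator E Q = (\<lambda>(u, v).
     (v, - (THE h. represents E (\<lambda>w. P_ext E u w + Q_adj Q (Q v) w) h)))"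

definition shifted_generator ::
    "(real \<Rightarrow> 'a::complex_hilbert \<Rightarrow> 'a) \<Rightarrow> ('a \<Rightarrow> 'b::complex_hilbert) \<Rightarrow> complex \<Rightarrow>
     'a \<times> 'a \<Rightarrow> 'a \<times> 'a" where
  "shifted_generator E Q z U =
     (fst (generator E Q U) + z *\<^sub>C fst U, snd (generator E Q U) + z *\<^sub>C snd U)"

definition boundedly_invertible ::
    "(real \<Rightarrow> 'a::complex_hilbert \<Rightarrow> 'a) \<Rightarrow> ('a \<Rightarrow> 'b::complex_hilbert) \<Rightarrow> complex \<Rightarrow> bool" where
  "boundedly_invertible E Q z \<longleftrightarrow>
     bij_betw (shifted_generator E Q z) (generator_dom E Q) (energy_space E) \<and>
     (\<exists>K. \<forall>F\<in>energy_space E.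
        energy_norm E (inv_into (generator_dom E Q) (shifted_generator E Q z) F)
          \<le> K * energy_norm E F)"

text \<open>The operator norm of the inverse of the generator shifted by \<open>z\<close>, infinite if there is no
  bounded inverse.\<close>

definition resolvent_norm ::
    "(real \<Rightarrow> 'a::complex_hilbert \<Rightarrow> 'a) \<Rightarrow> ('a \<Rightarrow> 'b::complex_hilbert) \<Rightarrow> complex \<Rightarrow> ennreal" where
  "resolvent_norm E Q z =
     (if boundedly_invertible E Q z
      then SUP F \<in> {F \<in> energy_space E. energy_norm E F \<le> 1}.
             ennreal (energy_norm E (inv_into (generator_dom E Q) (shifted_generator E Q z) F))
      else \<infinity>)"

end

theory Submission
  imports Defs "HOL-Probability.Distribution_Functions"
begin

text \<open>
  Let \<open>P u = \<lambda>\<^sup>2 u\<close> with \<open>\<lambda> \<ge> 1\<close>, put \<open>h = (1 + \<lambda>\<^sup>-\<^sup>2 P)\<^sup>-\<^sup>1\<^sup>/\<^sup>2 Q\<^sup>* Q u\<close> and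
  \<open>z = - (\<i> / \<lambda>) (1 + \<lambda>\<^sup>-\<^sup>2 P)\<^sup>-\<^sup>1\<^sup>/\<^sup>2 h\<close>. Then \<open>U = (u - z, - \<i> \<lambda> u)\<close> lies in the domain of the generator
  \<open>A\<close> and \<open>(A + \<i> \<lambda>) U = (- \<i> \<lambda> z, - \<lambda>\<^sup>2 z)\<close> has energy norm at most \<open>2 \<lambda> \<parallel>h\<parallel>\<close>, whereas the energy
  norm of \<open>U\<close> is at least \<open>\<lambda> \<parallel>u\<parallel>\<close>. As \<open>u\<close> is an eigenvector, \<open>m\<close>-boundedness says
  \<open>\<parallel>h\<parallel> \<le> C m(\<lambda>) \<parallel>u\<parallel>\<close>.

  Eigenvalues tending to infinity are read off the spectral family: a sequence of unit vectors in the
  range of a fixed \<open>E\<^sub>R\<close> is bounded in the graph norm of \<open>P\<close>, so it has a convergent subsequence,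
  and hence \<open>r \<mapsto> E\<^sub>r\<close> is locally constant except for isolated jumps. The spectral measures are
  then purely atomic, and the functional calculus acts diagonally on the jumps.
\<close>

section \<open>Hilbert spaces\<close>

lemma cinner_zero_left [simp]: "cinner 0 y = 0"
  using cinner_add_left[of 0 0 y] by simp

lemma cinner_add_right: "cinner x (y + z) = cinner x y + cinner x z"
  using cinner_add_left[of y z x] by (metis cinner_commute complex_cnj_add)

lemma cinner_scaleC_right: "cinner x (a *\<^sub>C y) = cnj a * cinner x y"
  using cinner_scaleC_left[of a y x] by (metis cinner_commute complex_cnj_mult)

lemma scaleC_one [simp]: "1 *\<^sub>C x = (x :: 'a :: complex_hilbert)"
  using scaleC_of_real[of 1 x] by simp

lemma scaleC_minus_one: "(- 1) *\<^sub>C x = - (x :: 'a :: complex_hilbert)"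
  using scaleC_of_real[of "-1" x] by simp

lemma cinner_scaleR_left: "cinner (r *\<^sub>R x) y = r *\<^sub>R cinner x y"
  by (metis cinner_scaleC_left scaleC_of_real scaleR_conv_of_real)

lemma cinner_scaleR_right: "cinner x (r *\<^sub>R y) = r *\<^sub>R cinner x y"
  by (metis cinner_scaleC_right scaleC_of_real scaleR_conv_of_real complex_cnj_complex_of_real)

lemma Re_cinner_self: "Re (cinner x x) = (norm x)\<^sup>2"
  by (simp add: cinner_self)

lemma Re_cinner_commute: "Re (cinner x y) = Re (cinner y x)"
  by (metis cinner_commute complex_cnj(1) cnj.sel(1))

lemma norm_add_sq: "(norm (x + y))\<^sup>2 = (norm x)\<^sup>2 + (norm y)\<^sup>2 + 2 * Re (cinner x y)"
  unfolding Re_cinner_self[symmetric]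
  by (simp add: cinner_add_left cinner_add_right Re_cinner_commute[of y x])

lemma norm_scaleC: "norm (a *\<^sub>C x) = cmod a * norm x"
proof -
  have "complex_of_real ((norm (a *\<^sub>C x))\<^sup>2) = complex_of_real ((cmod a * norm x)\<^sup>2)"
    unfolding cinner_self[symmetric] cinner_scaleC_left cinner_scaleC_right
    using complex_norm_square[of a] by (simp add: cinner_self power_mult_distrib)
  then have "(norm (a *\<^sub>C x))\<^sup>2 = (cmod a * norm x)\<^sup>2"
    by (simp only: of_real_eq_iff)
  then show ?thesis
    by (simp add: power2_eq_iff_nonneg)
qed

text \<open>Expand the square of \<open>norm y *\<^sub>R x - norm x *\<^sub>R y\<close> and divide
  by \<open>2 * (norm x * norm y)\<close>.\<close>

lemma Re_cinner_le: "Re (cinner x y) \<le> norm x * norm y"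
proof (cases "y = 0 \<or> x = 0")
  case True
  then show ?thesis using cinner_add_right[of x 0 0] by auto
next
  case False
  have "(norm (norm y *\<^sub>R x + (- norm x) *\<^sub>R y))\<^sup>2 \<ge> 0" by simp
  then have "2 * (norm x * norm y) * Re (cinner x y) \<le> 2 * (norm x * norm y) * (norm x * norm y)"
    unfolding norm_add_sq cinner_scaleR_left cinner_scaleR_right
    by (simp add: power_mult_distrib power2_eq_square algebra_simps)
  then show ?thesis using False by simp
qed

text \<open>A unimodular factor on \<open>x\<close> makes the inner product equal to its modulus, so
  the bound on real parts applies.\<close>

lemma Cauchy_Schwarz_cinner: "cmod (cinner x y) \<le> norm x * norm y"
proof (cases "cinner x y = 0")
  case False
  define a where "a = cnj (cinner x y) / cmod (cinner x y)"
  have "cmod a = 1" using False by (simp add: a_def norm_divide)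
  have "cinner (a *\<^sub>C x) y = cmod (cinner x y)"
    using False by (simp add: a_def cinner_scaleC_left complex_norm_square[symmetric]
        power2_eq_square mult.commute[of "cnj _"])
  then show ?thesis
    using Re_cinner_le[of "a *\<^sub>C x" y] \<open>cmod a = 1\<close> by (simp add: norm_scaleC)
qed simp

lemma bounded_bilinear_cinner: "bounded_bilinear cinner"
  by standard (auto simp: cinner_add_left cinner_add_right cinner_scaleR_left cinner_scaleR_right
      intro!: exI[of _ 1] Cauchy_Schwarz_cinner)

lemma scaleC_scaleR: "a *\<^sub>C r *\<^sub>R x = r *\<^sub>R a *\<^sub>C (x :: 'a :: complex_hilbert)"
  by (metis mult.commute scaleC_of_real scaleC_scaleC)

lemma bounded_bilinear_scaleC: "bounded_bilinear (scaleC :: _ \<Rightarrow> 'a :: complex_hilbert \<Rightarrow> _)"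
proof
  show "(r *\<^sub>R a) *\<^sub>C b = r *\<^sub>R a *\<^sub>C b" for r a and b :: 'a
    by (metis scaleC_of_real scaleC_scaleC scaleR_conv_of_real)
  show "a *\<^sub>C r *\<^sub>R b = r *\<^sub>R a *\<^sub>C b" for r a and b :: 'a
    by (rule scaleC_scaleR)
qed (auto simp: scaleC_add_left scaleC_add_right norm_scaleC intro!: exI[of _ 1])

interpretation cinner: bounded_bilinear cinner
  by (rule bounded_bilinear_cinner)

interpretation scaleC: bounded_bilinear "scaleC :: _ \<Rightarrow> 'a :: complex_hilbert \<Rightarrow> _"
  by (rule bounded_bilinear_scaleC)

lemma cinner_eqI: "(\<And>v. cinner x v = cinner y v) \<Longrightarrow> x = y"
  using cinner.diff_left[of x y "x - y"] by (simp add: cinner_self)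

lemma norm_diff_sq: "(norm (x - y))\<^sup>2 = (norm x)\<^sup>2 + (norm y)\<^sup>2 - 2 * Re (cinner x y)"
  using norm_add_sq[of x "- y"] by (simp add: cinner.minus_right)

lemma parallelogram: "(norm (x + y))\<^sup>2 + (norm (x - y))\<^sup>2
    = 2 * (norm x)\<^sup>2 + 2 * (norm (y :: 'a :: complex_hilbert))\<^sup>2"
  by (simp add: norm_add_sq norm_diff_sq)

lemma norm_add_sq_le: "(norm (x + y))\<^sup>2 \<le> 2 * (norm x)\<^sup>2 + 2 * (norm (y :: 'a :: complex_hilbert))\<^sup>2"
  using parallelogram[of x y] zero_le_power2[of "norm (x - y)"] by linarith

text \<open>The weights are those of \<open>spectral_integral\<close>, so this identity turns
  polarised scalar integrals back into inner products.\<close>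

lemma polarization:
  "(\<Sum>k<4. \<i> ^ k * complex_of_real ((norm (u + \<i> ^ k *\<^sub>C v))\<^sup>2)) / 4 = cinner u v"
proof -
  have "(norm (u + v))\<^sup>2 - (norm (u + (- 1) *\<^sub>C v))\<^sup>2 = 4 * Re (cinner u v)"
    "(norm (u + \<i> *\<^sub>C v))\<^sup>2 - (norm (u + (- \<i>) *\<^sub>C v))\<^sup>2 = 4 * Im (cinner u v)"
    unfolding norm_add_sq cinner_scaleC_right norm_scaleC by simp_all
  then show ?thesis
    by (simp add: eval_nat_numeral complex_eq_iff)
qed

lemma clinear_onD:
  assumes "clinear_on S T"
  shows "x \<in> S \<Longrightarrow> y \<in> S \<Longrightarrow> T (x + y) = T x + T y" "x \<in> S \<Longrightarrow> T (a *\<^sub>C x) = a *\<^sub>C T x"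
    "0 \<in> S" "x \<in> S \<Longrightarrow> y \<in> S \<Longrightarrow> x + y \<in> S" "x \<in> S \<Longrightarrow> a *\<^sub>C x \<in> S"
  using assms unfolding clinear_on_def complex_vector.subspace_def by auto

text \<open>The representing vector minimises \<open>\<parallel>x\<parallel>\<^sup>2 - 2 Re (\<phi> x)\<close>; minimising sequences are Cauchy by the
  parallelogram law.\<close>

lemma Riesz_representation:
  fixes phi :: "'a :: complex_hilbert \<Rightarrow> complex"
  assumes add: "\<And>x y. phi (x + y) = phi x + phi y"
    and scale: "\<And>a x. phi (a *\<^sub>C x) = a * phi x"
    and bound: "\<And>x. cmod (phi x) \<le> K * norm x"
  shows "\<exists>h. \<forall>v. phi v = cinner v h"
proof -
  have scaleR: "phi (r *\<^sub>R x) = r *\<^sub>R phi x" for r x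
    by (metis scale scaleC_of_real scaleR_conv_of_real)
  interpret phi: bounded_linear phi
    by standard (auto simp: add scaleR intro!: exI[of _ K] bound[unfolded mult.commute[of K]])
  define J where "J x = (norm x)\<^sup>2 - 2 * Re (phi x)" for x
  have below: "J x \<ge> - K\<^sup>2" for x
  proof -
    have "Re (phi x) \<le> K * norm x" using bound[of x] complex_Re_le_cmod order_trans by blast
    moreover have "(norm x - K)\<^sup>2 \<ge> 0" by simp
    ultimately show ?thesis unfolding J_def power2_diff
      by (simp add: mult.assoc mult.commute[of "norm x" K])
  qed
  define d where "d = Inf (range J)"
  have bdd: "bdd_below (range J)" using below by (auto intro!: bdd_belowI)
  have d: "d \<le> J x" for x unfolding d_def using bdd by (auto intro: cInf_lower)
  have "\<exists>x. J x < d + 1 / real (Suc n)" for n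
    using cInf_lessD[of "range J" "d + 1 / real (Suc n)"] unfolding d_def by auto
  then obtain x where x: "\<And>n. J (x n) < d + 1 / real (Suc n)" by metis
  \<comment> \<open>The linear terms of \<open>J\<close> cancel and the parallelogram law remains.
    Two points with \<open>J\<close> close to \<open>d\<close> are therefore close to each other,
    since \<open>J\<close> is at least \<open>d\<close> at their midpoint.\<close>
  have mid: "(norm (y - z))\<^sup>2 = 2 * J y + 2 * J z - 4 * J ((1/2) *\<^sub>R (y + z))" for y z
    using parallelogram[of y z]
    by (simp add: J_def phi.scaleR phi.add power_mult_distrib power2_eq_square
        scaleR_add_right[symmetric] algebra_simps del: scaleR_add_right)
  have lim0: "(\<lambda>n. J (x n)) \<longlonglongrightarrow> d"
  proof (rule tendsto_sandwich[of "\<lambda>_. d" _ _ "\<lambda>n. d + 1 / real (Suc n)"])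
    show "(\<lambda>n. d + 1 / real (Suc n)) \<longlonglongrightarrow> d"
      using tendsto_add[OF tendsto_const[of d] LIMSEQ_inverse_real_of_nat]
      by (simp add: divide_inverse)
  qed (use d x in \<open>auto intro!: always_eventually less_imp_le\<close>)
  have "Cauchy x"
  proof (rule metric_CauchyI)
    fix e :: real assume "e > 0"
    then have "eventually (\<lambda>n. J (x n) < d + e\<^sup>2 / 4) sequentially"
      using lim0 by (intro order_tendstoD(2)) auto
    then obtain N where N: "\<And>n. n \<ge> N \<Longrightarrow> J (x n) < d + e\<^sup>2 / 4"
      by (auto simp: eventually_sequentially)
    have "norm (x i - x j) < e" if "i \<ge> N" "j \<ge> N" for i j
    proof -
      have "(norm (x i - x j))\<^sup>2 < e\<^sup>2"
        using mid[of "x i" "x j"] N[OF that(1)] N[OF that(2)] d[of "(1/2) *\<^sub>R (x i + x j)"]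
        by linarith
      then show ?thesis using \<open>e > 0\<close> by (simp add: power2_less_imp_less)
    qed
    then show "\<exists>M. \<forall>i\<ge>M. \<forall>j\<ge>M. dist (x i) (x j) < e" by (auto simp: dist_norm)
  qed
  then obtain h where h: "x \<longlonglongrightarrow> h" by (auto simp: Cauchy_convergent_iff convergent_def)
  have "(\<lambda>n. J (x n)) \<longlonglongrightarrow> J h"
    unfolding J_def by (intro tendsto_intros h phi.tendsto)
  then have "J h = d" using lim0 LIMSEQ_unique by blast
  have Re_eq: "Re (phi v) = Re (cinner v h)" for v
  proof -
    define c where "c = Re (phi v) - Re (cinner v h)"
    \<comment> \<open>The vertex of the parabola \<open>t \<mapsto> J (h + t *\<^sub>R v)\<close>
      would be \<open>c / (norm v)\<^sup>2\<close>; the \<open>+ 1\<close> keeps the denominator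
      positive when \<open>v = 0\<close>, and minimality of \<open>h\<close> still forces
      \<open>t = 0\<close>.\<close>
    define t where "t = c / ((norm v)\<^sup>2 + 1)"
    have "J (h + t *\<^sub>R v) = J h + t\<^sup>2 * (norm v)\<^sup>2 - 2 * t * c"
      by (simp add: J_def c_def norm_add_sq phi.add phi.scaleR cinner_scaleR_right
          Re_cinner_commute[of h] power_mult_distrib algebra_simps)
    then have "2 * t * c \<le> t\<^sup>2 * (norm v)\<^sup>2" using d[of "h + t *\<^sub>R v"] \<open>J h = d\<close> by linarith
    moreover have c: "c = t * ((norm v)\<^sup>2 + 1)"
      using zero_le_power2[of "norm v"] unfolding t_def by (simp add: add_nonneg_eq_0_iff)
    ultimately have "t\<^sup>2 * ((norm v)\<^sup>2 + 2) \<le> 0"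
      by (simp add: power2_eq_square algebra_simps)
    then have "t = 0"
      by (smt (verit) mult_pos_pos zero_less_power2 zero_le_power2)
    then show ?thesis using c by (simp add: c_def)
  qed
  have "phi v = cinner v h" for v
    using Re_eq[of v] Re_eq[of "\<i> *\<^sub>C v"] by (simp add: complex_eq_iff scale cinner_scaleC_left)
  then show ?thesis by blast
qed

section \<open>Spectral families\<close>

locale spectral_fam =
  fixes E :: "real \<Rightarrow> 'a::complex_hilbert \<Rightarrow> 'a"
  assumes family: "spectral_family E"
begin

lemma E_clinear: "clinear_on UNIV (E r)"
  and E_sym: "cinner (E r u) v = cinner u (E r v)"
  and E_E: "E r (E s u) = E (min r s) u"
  and E_right: "((\<lambda>s. E s u) \<longlongrightarrow> E r u) (at_right r)"
  and E_neg: "r < 0 \<Longrightarrow> E r u = 0"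
  and E_top: "((\<lambda>r. E r u) \<longlongrightarrow> u) at_top"
  using family unfolding spectral_family_def by auto

lemma E_add: "E r (u + v) = E r u + E r v"
  and E_scaleC: "E r (a *\<^sub>C u) = a *\<^sub>C E r u"
  using clinear_onD(1,2)[OF E_clinear] by auto

lemma E_scaleR: "E r (a *\<^sub>R u) = a *\<^sub>R E r u"
  by (metis E_scaleC scaleC_of_real)

lemma E_diff: "E r (u - v) = E r u - E r v"
  by (metis E_add add_diff_cancel diff_add_cancel)

lemma cinner_E_E: "cinner (E r u) (E s v) = cinner (E (min r s) u) v"
  by (metis E_sym E_E min.commute)

text \<open>Pythagoras: \<open>E r\<close> and \<open>E s\<close> are commuting orthogonal
  projections, and their product is \<open>E r\<close>.\<close>

lemma norm_E_diff: "r \<le> s \<Longrightarrow> (norm (E s u - E r u))\<^sup>2 = (norm (E s u))\<^sup>2 - (norm (E r u))\<^sup>2"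
  unfolding norm_diff_sq unfolding Re_cinner_self[symmetric] cinner_E_E by simp

lemma norm_minus_E: "(norm (u - E r u))\<^sup>2 = (norm u)\<^sup>2 - (norm (E r u))\<^sup>2"
  unfolding norm_diff_sq unfolding Re_cinner_self[symmetric] cinner_E_E by (simp add: E_sym[symmetric])

lemma norm_E_mono: "r \<le> s \<Longrightarrow> (norm (E r u))\<^sup>2 \<le> (norm (E s u))\<^sup>2"
  using norm_E_diff[of r s u] zero_le_power2[of "norm (E s u - E r u)"] by linarith

lemma norm_minus_E_le: "norm (u - E r u) \<le> norm u"
  using norm_minus_E[of u r] by (simp add: power2_le_imp_le)

lemma norm_E_right: "continuous (at_right a) (\<lambda>r. (norm (E r u))\<^sup>2)"
  unfolding continuous_within by (intro tendsto_intros E_right)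

lemma norm_E_bot: "((\<lambda>r. (norm (E r u))\<^sup>2) \<longlongrightarrow> 0) at_bot"
  by (rule tendsto_eventually)
     (use E_neg in \<open>auto simp: eventually_at_bot_linorder intro!: exI[of _ "-1"]\<close>)

lemma norm_E_top: "((\<lambda>r. (norm (E r u))\<^sup>2) \<longlongrightarrow> (norm u)\<^sup>2) at_top"
  by (intro tendsto_intros E_top)

section \<open>Spectral measures of half-lines\<close>

lemma finite_borel_spectral_measure: "finite_borel_measure (spectral_measure E u)"
  unfolding spectral_measure_def
  by (rule finite_borel_measure_interval_measure[OF norm_E_mono norm_E_right norm_E_bot norm_E_top])
     auto

sublocale spectral_measure: finite_borel_measure "spectral_measure E u" for u
  by (rule finite_borel_spectral_measure)

lemma sets_spectral_measure [simp, measurable_cong]: "sets (spectral_measure E u) = sets borel"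
  and space_spectral_measure [simp]: "space (spectral_measure E u) = UNIV"
  by (simp_all add: spectral_measure_def)

lemma measure_spectral_Iic: "measure (spectral_measure E u) {..r} = (norm (E r u))\<^sup>2"
  unfolding spectral_measure_def
  by (rule measure_interval_measure_Iic[OF norm_E_mono norm_E_right norm_E_bot])

lemma measure_spectral_UNIV: "measure (spectral_measure E u) UNIV = (norm u)\<^sup>2"
  using interval_measure_UNIV[OF norm_E_mono norm_E_right norm_E_bot norm_E_top[of u]]
  by (simp add: spectral_measure_def measure_def)

lemma measure_spectral_Ioi: "measure (spectral_measure E u) {r<..} = (norm (u - E r u))\<^sup>2"
proof -
  have "{r<..} = UNIV - {..r}" by auto
  then show ?thesis
    using spectral_measure.finite_measure_compl[of "{..r}" u]
    by (simp add: measure_spectral_UNIV measure_spectral_Iic norm_minus_E)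
qed

text \<open>The mass of \<open>{..<0}\<close> is the left limit at \<open>0\<close> of the
  distribution function, which vanishes. An atom at \<open>0\<close> itself remains
  possible.\<close>

lemma AE_spectral_nonneg: "AE r in spectral_measure E u. 0 \<le> r"
proof -
  have "((\<lambda>r. (norm (E r u))\<^sup>2) \<longlongrightarrow> 0) (at_left 0)"
    by (rule tendsto_eventually) (use E_neg in \<open>auto simp: eventually_at intro!: exI[of _ 1]\<close>)
  then have "measure (spectral_measure E u) {..<0} = 0"
    using spectral_measure.cdf_at_left[of u 0] tendsto_unique[OF trivial_limit_at_left_real]
    unfolding cdf_def measure_spectral_Iic by blast
  then have "{..<0} \<in> null_sets (spectral_measure E u)"
    by (auto simp: spectral_measure.emeasure_eq_measure)
  then show ?thesis by (rule AE_I') auto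
qed

lemma AE_spectral_le: "E R u = u \<Longrightarrow> AE r in spectral_measure E u. r \<le> R"
  by (rule AE_I'[of "{R<..}"])
     (auto simp: null_sets_def spectral_measure.emeasure_eq_measure measure_spectral_Ioi)

text \<open>The layer-cake formula turns the quadratic form of \<open>P\<close> into an integral in which the vector
  enters through \<open>\<parallel>u - E\<^sub>t u\<parallel>\<^sup>2\<close> pointwise, so that it can be polarised under the integral sign.\<close>

definition layer :: "'a \<Rightarrow> real \<Rightarrow> real" where
  "layer u t = indicator {0..} t * (2 * t) * (norm (u - E t u))\<^sup>2"

text \<open>By Pythagoras the function is decreasing in \<open>t\<close>, and monotone functions are
  Borel.\<close>

lemma measurable_norm_minus_E [measurable]: "(\<lambda>t. (norm (u - E t u))\<^sup>2) \<in> borel_measurable borel"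
proof -
  have "(\<lambda>t. - (norm (u - E t u))\<^sup>2) \<in> borel_measurable borel"
    by (rule borel_measurable_mono) (auto simp: mono_def norm_minus_E norm_E_mono simp del: power_mono_iff power2_le_iff_abs_le)
  then show ?thesis by simp
qed

text \<open>As \<open>u \<mapsto> u - E t u\<close> is an orthogonal projection, \<open>v\<close>
  may be replaced by \<open>v - E t v\<close>; polarisation then reduces the claim to squared
  norms.\<close>

lemma measurable_cinner_minus_E [measurable]:
  "(\<lambda>t. cinner v (u - E t u)) \<in> borel_measurable borel"
proof -
  have "cinner v (u - E t u) = (\<Sum>k<4. \<i> ^ k *
      complex_of_real ((norm ((v + \<i> ^ k *\<^sub>C u) - E t (v + \<i> ^ k *\<^sub>C u)))\<^sup>2)) / 4" for t
  proof -
    have "cinner v (u - E t u) = cinner (v - E t v) (u - E t u)"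
      by (simp add: cinner.diff_left cinner.diff_right E_sym E_E)
    also have "\<dots> = (\<Sum>k<4. \<i> ^ k *
      complex_of_real ((norm ((v - E t v) + \<i> ^ k *\<^sub>C (u - E t u)))\<^sup>2)) / 4"
      by (rule polarization[symmetric])
    finally show ?thesis by (simp add: E_add E_scaleC scaleC.diff_right algebra_simps)
  qed
  then show ?thesis by (simp only:) measurable
qed

lemma layer_nonneg: "0 \<le> layer u t"
  by (simp add: layer_def indicator_def)

lemma measurable_layer [measurable]: "layer u \<in> borel_measurable borel"
  unfolding layer_def[abs_def] by measurable

text \<open>Write \<open>r\<^sup>2\<close> as the integral of \<open>2 * t\<close> over
  \<open>0 \<le> t < r\<close> and apply Tonelli's theorem; what remains inside is the mass of
  \<open>{t<..}\<close>.\<close>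

lemma nn_integral_layer:
  "(\<integral>\<^sup>+r. ennreal (r\<^sup>2) \<partial>spectral_measure E u) = (\<integral>\<^sup>+t. ennreal (layer u t) \<partial>lborel)"
proof -
  define f :: "real \<times> real \<Rightarrow> ennreal" where
    "f p = ennreal (2 * snd p) * indicator {p. 0 \<le> snd p \<and> snd p < fst p} p" for p
  interpret pair_sigma_finite "spectral_measure E u" "lborel :: real measure" ..
  have [measurable]: "f \<in> borel_measurable (spectral_measure E u \<Otimes>\<^sub>M lborel)"
    unfolding f_def[abs_def] by measurable
  have inner: "(\<integral>\<^sup>+t. f (r, t) \<partial>lborel) = ennreal (r\<^sup>2)" if "0 \<le> r" for r
  proof -
    have "(\<integral>\<^sup>+t. f (r, t) \<partial>lborel) = (\<integral>\<^sup>+t. ennreal (2 * t) * indicator {0..r} t \<partial>lborel)"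
    proof (rule nn_integral_cong_AE)
      \<comment> \<open>The strict inequality in \<open>f\<close> is the one that produces
        \<open>{t<..}\<close>; compared with \<open>{0..r}\<close> it only misses the null point
        \<open>t = r\<close>.\<close>
      show "AE t in lborel. f (r, t) = ennreal (2 * t) * indicator {0..r} t"
        using AE_lborel_singleton[of r] by eventually_elim (auto simp: f_def indicator_def)
    qed
    also have "\<dots> = ennreal (r\<^sup>2 - 0\<^sup>2)"
      using that by (intro nn_integral_FTC_Icc)
        (auto intro!: derivative_eq_intros simp: has_real_derivative_iff_has_vector_derivative[symmetric])
    finally show ?thesis by simp
  qed
  have "(\<integral>\<^sup>+r. ennreal (r\<^sup>2) \<partial>spectral_measure E u)
      = (\<integral>\<^sup>+r. (\<integral>\<^sup>+t. f (r, t) \<partial>lborel) \<partial>spectral_measure E u)"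
    by (rule nn_integral_cong_AE) (use AE_spectral_nonneg[of u] inner in auto)
  also have "\<dots> = (\<integral>\<^sup>+t. (\<integral>\<^sup>+r. f (r, t) \<partial>spectral_measure E u) \<partial>lborel)"
    by (rule Fubini'[symmetric]) simp
  also have "\<dots> = (\<integral>\<^sup>+t. ennreal (layer u t) \<partial>lborel)"
  proof (rule nn_integral_cong)
    fix t :: real
    have "(\<integral>\<^sup>+r. f (r, t) \<partial>spectral_measure E u)
        = (\<integral>\<^sup>+r. (ennreal (2 * t) * indicator {0..} t) * indicator {t<..} r \<partial>spectral_measure E u)"
      by (rule nn_integral_cong) (auto simp: f_def indicator_def)
    also have "\<dots> = (ennreal (2 * t) * indicator {0..} t) * ennreal ((norm (u - E t u))\<^sup>2)"
      by (subst nn_integral_cmult)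
         (auto simp: spectral_measure.emeasure_eq_measure measure_spectral_Ioi)
    also have "\<dots> = ennreal (layer u t)"
      by (auto simp: layer_def indicator_def ennreal_mult)
    finally show "(\<integral>\<^sup>+r. f (r, t) \<partial>spectral_measure E u) = ennreal (layer u t)" .
  qed
  finally show ?thesis .
qed

lemma integrable_layer_iff:
  "integrable (spectral_measure E u) (\<lambda>r. r\<^sup>2) \<longleftrightarrow> integrable lborel (layer u)"
  by (simp add: integrable_iff_bounded layer_nonneg nn_integral_layer)

lemma integral_layer: "(\<integral>r. r\<^sup>2 \<partial>spectral_measure E u) = (\<integral>t. layer u t \<partial>lborel)"
  by (simp add: integral_eq_nn_integral layer_nonneg nn_integral_layer)

text \<open>This domination makes all four polarised layers integrable once those of
  \<open>u\<close> and \<open>v\<close> are.\<close>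

lemma layer_add_le: "cmod a = 1 \<Longrightarrow> layer (u + a *\<^sub>C v) t \<le> 2 * layer u t + 2 * layer v t"
proof -
  assume a: "cmod a = 1"
  have "(norm ((u - E t u) + a *\<^sub>C (v - E t v)))\<^sup>2 \<le> 2 * (norm (u - E t u))\<^sup>2 + 2 * (norm (v - E t v))\<^sup>2"
    using norm_add_sq_le[of "u - E t u" "a *\<^sub>C (v - E t v)"] a by (simp add: norm_scaleC)
  then have "(norm ((u + a *\<^sub>C v) - E t (u + a *\<^sub>C v)))\<^sup>2 \<le> 2 * (norm (u - E t u))\<^sup>2 + 2 * (norm (v - E t v))\<^sup>2"
    by (simp add: E_add E_scaleC scaleC.diff_right algebra_simps)
  then have "indicator {0..} t * (2 * t) * (norm ((u + a *\<^sub>C v) - E t (u + a *\<^sub>C v)))\<^sup>2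
     \<le> indicator {0..} t * (2 * t) * (2 * (norm (u - E t u))\<^sup>2 + 2 * (norm (v - E t v))\<^sup>2)"
    by (intro mult_left_mono) (auto simp: indicator_def)
  then show ?thesis by (simp add: layer_def algebra_simps)
qed

text \<open>Membership in \<open>fdom\<close> concerns the fourth power of \<open>r\<close>; the
  measure being finite, \<open>x \<le> 1 + x\<^sup>2\<close> passes to the second power.\<close>

lemma fdom_id_integrable:
  assumes "u \<in> fdom E (\<lambda>x. x)"
  shows "integrable (spectral_measure E u) (\<lambda>r. r\<^sup>2)"
proof (rule Bochner_Integration.integrable_bound[of _ "\<lambda>r. 1 + (r\<^sup>2)\<^sup>2"])
  have "x \<le> 1 + x\<^sup>2" if "0 \<le> x" for x :: real
    using that zero_le_power2[of "x - 1"] unfolding power2_diff by simp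
  from this[of "r\<^sup>2" for r] show "AE r in spectral_measure E u. norm (r\<^sup>2) \<le> norm (1 + (r\<^sup>2)\<^sup>2)"
    by simp
qed (use assms in \<open>auto simp: fdom_def\<close>)

text \<open>With integrable layers the polarisation can be carried out pointwise in
  \<open>t\<close>. Sesquilinearity becomes evident, without knowing yet that the spectrum is
  discrete.\<close>

lemma spectral_integral_layer:
  assumes "u \<in> fdom E (\<lambda>x. x)" "v \<in> fdom E (\<lambda>x. x)"
  shows "spectral_integral E (\<lambda>x. x) u v
    = (\<integral>t. (indicator {0..} t * (2 * t)) *\<^sub>R cinner (u - E t u) v \<partial>lborel)"
proof -
  have int: "integrable lborel (layer (u + \<i> ^ k *\<^sub>C v))" for k
    by (rule Bochner_Integration.integrable_bound[of _ "\<lambda>t. 2 * layer u t + 2 * layer v t"])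
       (use assms[THEN fdom_id_integrable, unfolded integrable_layer_iff] in
        \<open>auto simp: layer_nonneg norm_power intro!: always_eventually layer_add_le
            order_trans[OF _ abs_ge_self]\<close>)
  have "spectral_integral E (\<lambda>x. x) u v
      = (\<Sum>k<4. \<i> ^ k * (\<integral>t. complex_of_real (layer (u + \<i> ^ k *\<^sub>C v) t) \<partial>lborel)) / 4"
    by (simp add: spectral_integral_def integral_layer)
  also have "\<dots> = (\<integral>t. (\<Sum>k<4. \<i> ^ k * complex_of_real (layer (u + \<i> ^ k *\<^sub>C v) t)) / 4 \<partial>lborel)"
    using int by simp
  also have "\<dots> = (\<integral>t. (indicator {0..} t * (2 * t)) *\<^sub>R cinner (u - E t u) v \<partial>lborel)"
  proof (rule Bochner_Integration.integral_cong)
    fix t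
    have "(\<Sum>k<4. \<i> ^ k * complex_of_real (layer (u + \<i> ^ k *\<^sub>C v) t)) / 4
      = (indicator {0..} t * (2 * t)) *\<^sub>R ((\<Sum>k<4. \<i> ^ k *
          complex_of_real ((norm ((u - E t u) + \<i> ^ k *\<^sub>C (v - E t v)))\<^sup>2)) / 4)"
      by (simp add: layer_def E_add E_scaleC scaleC.diff_right scaleR_conv_of_real
          sum_distrib_left sum_divide_distrib algebra_simps)
    also have "\<dots> = (indicator {0..} t * (2 * t)) *\<^sub>R cinner (u - E t u) (v - E t v)"
      unfolding polarization ..
    also have "cinner (u - E t u) (v - E t v) = cinner (u - E t u) v"
      by (simp add: cinner.diff_left cinner.diff_right E_diff E_E E_sym[symmetric])
    finally show "(\<Sum>k<4. \<i> ^ k * complex_of_real (layer (u + \<i> ^ k *\<^sub>C v) t)) / 4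
      = (indicator {0..} t * (2 * t)) *\<^sub>R cinner (u - E t u) v" .
  qed simp
  finally show ?thesis .
qed

lemma fdom_id_cutoff:
  assumes "E R u = u"
  shows "u \<in> fdom E (\<lambda>x. x)"
proof -
  have "AE r in spectral_measure E u. norm ((r\<^sup>2)\<^sup>2) \<le> R ^ 4"
    using AE_spectral_nonneg AE_spectral_le[OF assms]
    by eventually_elim (simp add: power_mono flip: power_mult)
  then show ?thesis
    unfolding fdom_def by (auto intro!: spectral_measure.integrable_const_bound simp del: power_mult)
qed

text \<open>\<open>fcalc\<close> is a definite description, so its value has to be produced first:
  Riesz representation of the layer integral gives existence, density of the domain gives
  uniqueness. The constant comes from \<open>2 * t \<le> 2 * R\<close> on an interval of length
  \<open>R\<close>.\<close>

lemma norm_fcalc_id_cutoff: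
  assumes "E R u = u" "0 \<le> R" and dense: "closure (fdom E (\<lambda>x. x)) = UNIV"
  shows "norm (fcalc E (\<lambda>x. x) u) \<le> 2 * R\<^sup>2 * norm u"
proof -
  \<comment> \<open>The conjugate of the layer integrand: Riesz representation needs linearity in
    \<open>v\<close>, which sits in the antilinear slot of \<open>spectral_integral\<close>.\<close>
  define g where "g v t = (indicator {0..R} t * (2 * t)) *\<^sub>R cinner v (u - E t u)" for v t
  define phi where "phi v = (\<integral>t. g v t \<partial>lborel)" for v
  have g_le: "norm (g v t) \<le> indicator {0..R} t *\<^sub>R (2 * R * (norm v * norm u))" for v t
  proof -
    have "cmod (cinner v (u - E t u)) \<le> norm v * norm u"
      using Cauchy_Schwarz_cinner norm_minus_E_le mult_left_mono norm_ge_zero order_trans by metis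
    then have "0 \<le> t \<Longrightarrow> t \<le> R \<Longrightarrow> 2 * t * cmod (cinner v (u - E t u)) \<le> 2 * R * (norm v * norm u)"
      by (intro mult_mono) auto
    then show ?thesis by (auto simp: g_def indicator_def mult.commute[of "norm v"])
  qed
  have int0: "integrable lborel (\<lambda>t. indicator {0..R} t *\<^sub>R c)" for c :: real
    by (rule integrable_real_indicator[THEN integrable_scaleR_left, of _ "{0..R}"])
       (auto simp: emeasure_lborel_Icc_eq)
  have int: "integrable lborel (g v)" for v
    by (rule Bochner_Integration.integrable_bound[OF int0[of "2 * R * (norm v * norm u)"]])
       (use g_le in \<open>auto simp: g_def[abs_def] intro!: always_eventually order_trans[OF _ abs_ge_self]\<close>)
  have "cmod (phi v) \<le> 2 * R\<^sup>2 * norm u * norm v" for v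
  proof -
    have "cmod (phi v) \<le> (\<integral>t. norm (g v t) \<partial>lborel)" unfolding phi_def by simp
    also have "\<dots> \<le> (\<integral>t. indicator {0..R} t *\<^sub>R (2 * R * (norm v * norm u)) \<partial>lborel)"
      by (rule integral_mono) (use int int0 g_le in auto)
    also have "\<dots> = 2 * R\<^sup>2 * norm u * norm v"
      using \<open>0 \<le> R\<close> by (simp add: power2_eq_square)
    finally show ?thesis .
  qed
  note bound = this
  have "\<exists>h. \<forall>v. phi v = cinner v h"
  proof (rule Riesz_representation)
    show "phi (v + w) = phi v + phi w" for v w
    proof -
      have "g (v + w) = (\<lambda>t. g v t + g w t)"
        by (simp add: g_def cinner_add_left scaleR_add_right fun_eq_iff)
      then show ?thesis unfolding phi_def using int by simp
    qed
    show "phi (a *\<^sub>C v) = a * phi v" for a v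
    proof -
      have "g (a *\<^sub>C v) = (\<lambda>t. a * g v t)"
        by (simp add: g_def cinner_scaleC_left fun_eq_iff)
      then show ?thesis unfolding phi_def by simp
    qed
  qed (rule bound)
  then obtain h where h: "phi v = cinner v h" for v by blast
  have "norm h * norm h \<le> 2 * R\<^sup>2 * norm u * norm h"
    using bound[of h] unfolding h by (simp add: cinner_self power2_eq_square norm_mult)
  then have norm_h: "norm h \<le> 2 * R\<^sup>2 * norm u"
    by (cases "h = 0") auto
  have h_eq: "cinner h v = spectral_integral E (\<lambda>x. x) u v" if "v \<in> fdom E (\<lambda>x. x)" for v
  proof -
    have "cinner h v = cnj (phi v)" using h cinner_commute by metis
    also have "\<dots> = (\<integral>t. cnj (g v t) \<partial>lborel)" unfolding phi_def by simp
    also have "\<dots> = (\<integral>t. (indicator {0..} t * (2 * t)) *\<^sub>R cinner (u - E t u) v \<partial>lborel)"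
    proof (rule Bochner_Integration.integral_cong)
      fix t
      \<comment> \<open>Cutting the integral off at \<open>R\<close> therefore loses
        nothing.\<close>
      have "t > R \<Longrightarrow> E t u = u" using assms(1) E_E[of t R u] by simp
      then show "cnj (g v t) = (indicator {0..} t * (2 * t)) *\<^sub>R cinner (u - E t u) v"
        by (auto simp: g_def indicator_def scaleR_conv_of_real cinner_commute[of v])
    qed simp
    also have "\<dots> = spectral_integral E (\<lambda>x. x) u v"
      using spectral_integral_layer[OF fdom_id_cutoff[OF assms(1)] that] ..
    finally show ?thesis .
  qed
  have "fcalc E (\<lambda>x. x) u = h"
    unfolding fcalc_def
  proof (rule the_equality)
    show "w = h" if "\<forall>v\<in>fdom E (\<lambda>x. x). cinner w v = spectral_integral E (\<lambda>x. x) u v" for w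
    proof -
      have "closed {v. cinner w v = cinner h v}"
        by (intro closed_Collect_eq linear_continuous_on continuous_on_id
            bounded_linear.continuous_on[OF cinner.bounded_linear_right])
      moreover have "fdom E (\<lambda>x. x) \<subseteq> {v. cinner w v = cinner h v}"
        using that h_eq by auto
      ultimately have "{v. cinner w v = cinner h v} = UNIV"
        using dense closure_minimal by blast
      then show ?thesis by (intro cinner_eqI) auto
    qed
  qed (use h_eq in blast)
  then show ?thesis using norm_h by simp
qed

end

section \<open>Discreteness of the spectrum\<close>

text \<open>Each \<open>u n\<close> is the image under the compact inverse of \<open>P - z\<close>
  of a vector of norm at most \<open>B + cmod z * A\<close>.\<close>

lemma compact_resolvent_convergent_subseq:
  fixes u :: "nat \<Rightarrow> 'a::complex_hilbert"
  assumes "compact_resolvent D P" "\<And>n. u n \<in> D" "\<And>n. norm (u n) \<le> A" "\<And>n. norm (P (u n)) \<le> B"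
  shows "\<exists>l r. strict_mono r \<and> (\<lambda>n. u (r n)) \<longlonglongrightarrow> l"
proof -
  obtain z where bij: "bij_betw (\<lambda>u. P u - z *\<^sub>C u) D UNIV"
    and compact: "\<And>S. bounded S \<Longrightarrow> compact (closure (inv_into D (\<lambda>u. P u - z *\<^sub>C u) ` S))"
    using assms(1) unfolding compact_resolvent_def by blast
  define T where "T = (\<lambda>u. P u - z *\<^sub>C u)"
  have "norm (T (u n)) \<le> B + cmod z * A" for n
    unfolding T_def
    by (rule order_trans[OF norm_triangle_ineq4])
       (auto simp: norm_scaleC intro!: add_mono assms mult_left_mono)
  then have "bounded (range (\<lambda>n. T (u n)))" by (auto simp: bounded_iff)
  then have "compact (closure (inv_into D T ` range (\<lambda>n. T (u n))))"
    using compact unfolding T_def by blast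
  moreover have "u n \<in> closure (inv_into D T ` range (\<lambda>n. T (u n)))" for n
    using bij bij_betw_inv_into_left[of T D UNIV "u n"] assms(2)[of n] closure_subset
    unfolding T_def[symmetric] by (metis (no_types, lifting) image_eqI rangeI subsetD)
  ultimately show ?thesis
    unfolding compact_eq_seq_compact_metric seq_compact_def comp_def by meson
qed

text \<open>Take a vector outside the span of \<open>B\<close>, subtract its orthogonal projection
  onto that span and normalise.\<close>

lemma exists_unit_orthogonal:
  fixes B :: "'a::complex_hilbert set"
  assumes "infinite_dimensional TYPE('a)" "finite B"
    and unit: "\<And>b. b \<in> B \<Longrightarrow> norm b = 1"
    and orth: "\<And>b c. b \<in> B \<Longrightarrow> c \<in> B \<Longrightarrow> b \<noteq> c \<Longrightarrow> cinner b c = 0"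
  shows "\<exists>y. norm y = 1 \<and> (\<forall>b\<in>B. cinner y b = 0)"
proof -
  obtain x where x: "x \<notin> complex_vector.span B"
    using assms(1,2) unfolding infinite_dimensional_def by blast
  define y where "y = x - (\<Sum>b\<in>B. cinner x b *\<^sub>C b)"
  have "(\<Sum>b\<in>B. cinner x b *\<^sub>C b) \<in> complex_vector.span B"
    by (intro complex_vector.span_sum complex_vector.span_scale complex_vector.span_base)
  then have "y \<noteq> 0" using x by (auto simp: y_def)
  have "cinner y b = 0" if "b \<in> B" for b
  proof -
    have "(\<Sum>c\<in>B. cinner x c * cinner c b) = (\<Sum>c\<in>B. if c = b then cinner x b else 0)"
      using orth[OF _ that] unit[OF that]
      by (intro sum.cong) (auto simp: cinner_self)
    then show ?thesis
      using that \<open>finite B\<close> by (simp add: y_def cinner.diff_left cinner.sum_left cinner_scaleC_left)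
  qed
  then show ?thesis
    using \<open>y \<noteq> 0\<close> by (intro exI[of _ "(1 / norm y) *\<^sub>R y"]) (auto simp: cinner_scaleR_left)
qed

lemma exists_orthonormal_sequence:
  assumes "infinite_dimensional TYPE('a::complex_hilbert)"
  shows "\<exists>e :: nat \<Rightarrow> 'a. (\<forall>n. norm (e n) = 1) \<and> (\<forall>i j. i \<noteq> j \<longrightarrow> cinner (e i) (e j) = 0)"
proof -
  define pick :: "'a set \<Rightarrow> 'a" where
    "pick B = (SOME y. norm y = 1 \<and> (\<forall>b\<in>B. cinner y b = 0))" for B
  \<comment> \<open>The list records all earlier choices, so that the next vector can be picked
    orthogonal to them.\<close>
  define L where "L = rec_nat [] (\<lambda>n xs. xs @ [pick (set xs)])"
  define e where "e n = pick (set (L n))" for n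
  have L: "L 0 = []" "L (Suc n) = L n @ [e n]" for n
    by (simp_all add: L_def e_def)
  have set_L: "set (L n) = e ` {..<n}" for n
    by (induction n) (auto simp: L lessThan_Suc)
  have "norm (e n) = 1 \<and> (\<forall>m<n. cinner (e n) (e m) = 0)" for n
  proof (induction n rule: less_induct)
    case (less n)
    have "\<exists>y. norm y = 1 \<and> (\<forall>b\<in>e ` {..<n}. cinner y b = 0)"
    proof (rule exists_unit_orthogonal[OF assms])
      show "cinner b c = 0" if bc: "b \<in> e ` {..<n}" "c \<in> e ` {..<n}" "b \<noteq> c" for b c
      proof -
        obtain i j where ij: "b = e i" "c = e j" "i < n" "j < n"
          using bc(1,2) by (elim imageE) auto
        then have "i \<noteq> j" using bc(3) by blast
        then have "cinner (e i) (e j) = 0 \<or> cinner (e j) (e i) = 0"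
          using less.IH ij by (metis linorder_neqE_nat)
        then show ?thesis using ij by (metis cinner_commute complex_cnj_zero)
      qed
    qed (use less.IH in auto)
    from someI_ex[OF this] show ?case by (simp add: e_def[of n] pick_def set_L)
  qed
  then have e: "norm (e n) = 1" "m < n \<Longrightarrow> cinner (e n) (e m) = 0" for m n by auto
  then have "cinner (e i) (e j) = 0" if "i \<noteq> j" for i j
    using that by (metis cinner_commute complex_cnj_zero linorder_neqE_nat)
  then show ?thesis using e(1) by blast
qed

lemma powr_minus_half: "0 < x \<Longrightarrow> x powr (- 1 / 2) = 1 / sqrt x" for x :: real
  using powr_minus[of x "1/2"] by (simp add: powr_half_sqrt inverse_eq_divide)

text \<open>Relative compactness of the unit sphere in the range of each \<open>E R\<close> is the
  form in which the compact resolvent enters the study of the spectrum.\<close>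

locale compact_spectral_fam = spectral_fam E
  for E :: "real \<Rightarrow> 'a::complex_hilbert \<Rightarrow> 'a" +
  assumes cutoff_compact: "\<And>R u. (\<And>n. E R (u n) = u n) \<Longrightarrow> (\<And>n. norm (u n) = 1) \<Longrightarrow>
    \<exists>l (r :: nat \<Rightarrow> nat). strict_mono r \<and> (\<lambda>n. u (r n)) \<longlonglongrightarrow> l"
begin

section \<open>Local constancy of the spectral family\<close>

lemma norm_E_le: "norm (E r u) \<le> norm u"
proof (rule power2_le_imp_le)
  show "(norm (E r u))\<^sup>2 \<le> (norm u)\<^sup>2"
    using norm_minus_E[of u r] zero_le_power2[of "norm (u - E r u)"] by linarith
qed simp

lemma bounded_linear_E: "bounded_linear (E r)"
  by standard (auto simp: E_add E_scaleR intro!: exI[of _ 1] norm_E_le)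

lemmas tendsto_E = bounded_linear.tendsto[OF bounded_linear_E]

text \<open>Normalise a nonzero vector \<open>E s v - E r v\<close>: its spectral mass lies in
  \<open>{r<..s}\<close>.\<close>

lemma exists_unit_between:
  assumes "r \<le> s" "E r \<noteq> E s"
  shows "\<exists>u. norm u = 1 \<and> (\<forall>t\<le>r. E t u = 0) \<and> (\<forall>t\<ge>s. E t u = u)"
proof -
  obtain v where v: "E s v - E r v \<noteq> 0" using assms(2) by (metis eq_iff_diff_eq_0 ext)
  define u where "u = (1 / norm (E s v - E r v)) *\<^sub>R (E s v - E r v)"
  have "norm u = 1" using v by (simp add: u_def)
  moreover have "E t u = 0" if "t \<le> r" for t
    using that assms(1) by (simp add: u_def E_scaleR E_diff E_E min_absorb1)
  moreover have "E t u = u" if "t \<ge> s" for t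
    using that assms(1) by (simp add: u_def E_scaleR E_diff E_E min_absorb2)
  ultimately show ?thesis by blast
qed

lemma unit_limit_not_orthogonal:
  fixes u :: "nat \<Rightarrow> 'a"
  assumes "u \<longlonglongrightarrow> l" "\<And>n. norm (u n) = 1" "\<And>n. cinner (u n) l = 0"
  shows False
proof -
  have "(\<lambda>n. cinner (u n) l) \<longlonglongrightarrow> cinner l l" by (intro cinner.tendsto assms tendsto_const)
  then have "cinner l l = 0" using assms(3) by (simp add: LIMSEQ_const_iff)
  moreover have "(\<lambda>n. norm (u n)) \<longlonglongrightarrow> norm l" by (intro tendsto_norm assms)
  then have "norm l = 1" using assms(2) by (simp add: LIMSEQ_const_iff)
  ultimately show False by (simp add: cinner_self)
qed

text \<open>Otherwise there are unit vectors \<open>u n\<close> carried by spectral intervals that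
  approach \<open>x\<close> from the left. A subsequential limit \<open>l\<close> has no mass below
  \<open>x\<close>, whereas each \<open>u n\<close> has all its mass there, so the vectors are
  orthogonal to their own limit.\<close>

lemma E_constant_left: "\<exists>e>0. \<forall>s\<in>{x-e<..<x}. \<forall>s'\<in>{x-e<..<x}. E s = E s'"
proof (rule ccontr)
  assume contra: "\<not> ?thesis"
  have "\<exists>s s' u. x - 1 / real (Suc n) < s \<and> s < s' \<and> s' < x \<and> norm u = 1 \<and>
      (\<forall>t\<le>s. E t u = 0) \<and> (\<forall>t\<ge>s'. E t u = u)" for n
  proof -
    have "1 / real (Suc n) > 0" by simp
    then obtain s s' where "s \<in> {x - 1 / real (Suc n)<..<x}" "s' \<in> {x - 1 / real (Suc n)<..<x}" "E s \<noteq> E s'"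
      using contra by blast
    then have "E (min s s') \<noteq> E (max s s')" "min s s' < max s s'"
      "x - 1 / real (Suc n) < min s s'" "max s s' < x"
      by (auto simp: min_def max_def le_less)
    then obtain s s' where *: "x - 1 / real (Suc n) < s" "s < s'" "s' < x" "E s \<noteq> E s'"
      by blast
    then show ?thesis using exists_unit_between[of s s'] by (metis less_imp_le)
  qed
  then obtain s s' u where s: "\<And>n. x - 1 / real (Suc n) < s n" "\<And>n. s' n < x" "\<And>n. norm (u n) = 1"
    and u0: "\<And>n t. t \<le> s n \<Longrightarrow> E t (u n) = 0" and u1: "\<And>n t. t \<ge> s' n \<Longrightarrow> E t (u n) = u n"
    by metis
  obtain l r where r: "strict_mono (r :: nat \<Rightarrow> nat)" and l: "(\<lambda>n. u (r n)) \<longlonglongrightarrow> l"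
    using cutoff_compact[of x u] u1 s(2,3) less_imp_le by metis
  have El: "E t l = 0" if t: "t < x" for t
  proof -
    obtain N where N: "1 / real (Suc N) < x - t"
      using reals_Archimedean[of "x - t"] t by (auto simp: divide_inverse)
    have "E t (u (r n)) = 0" if "n \<ge> N" for n
    proof (rule u0)
      have "N \<le> r n" using seq_suble[OF r, of n] that by simp
      then have "1 / real (Suc (r n)) \<le> 1 / real (Suc N)" by (simp add: frac_le)
      then show "t \<le> s (r n)" using s(1)[of "r n"] N by linarith
    qed
    then have "(\<lambda>n. E t (u (r n))) \<longlonglongrightarrow> 0"
      by (intro tendsto_eventually) (auto simp: eventually_sequentially)
    then show ?thesis using tendsto_E[OF l] LIMSEQ_unique by blast
  qed
  show False
  proof (rule unit_limit_not_orthogonal[OF l])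
    show "cinner (u (r n)) l = 0" for n
      using E_sym[of "s' (r n)" "u (r n)" l] El[OF s(2)] u1[OF order_refl] cinner.zero_right by simp
  qed (rule s)
qed

text \<open>The same argument with intervals shrinking to \<open>x\<close> from the right. Here
  right-continuity turns \<open>E t l = l\<close> for \<open>t > x\<close> into
  \<open>E x l = l\<close>, while \<open>E x\<close> annihilates every \<open>u n\<close>.\<close>

lemma E_constant_right: "\<exists>e>0. \<forall>s\<in>{x..<x+e}. E s = E x"
proof (rule ccontr)
  assume contra: "\<not> ?thesis"
  have "\<exists>s u. s < x + 1 / real (Suc n) \<and> x \<le> s \<and> norm u = 1 \<and>
      (\<forall>t\<le>x. E t u = 0) \<and> (\<forall>t\<ge>s. E t u = u)" for n
  proof -
    have "1 / real (Suc n) > 0" by simp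
    then obtain s where "s \<in> {x..<x + 1 / real (Suc n)}" "E s \<noteq> E x"
      using contra by blast
    then show ?thesis using exists_unit_between[of x s] by (metis atLeastLessThan_iff)
  qed
  then obtain s u where s: "\<And>n. s n < x + 1 / real (Suc n)" "\<And>n. norm (u n) = 1"
    and u0: "\<And>n. E x (u n) = 0" and u1: "\<And>n t. t \<ge> s n \<Longrightarrow> E t (u n) = u n"
    by (metis order_refl)
  \<comment> \<open>This places all \<open>u n\<close> in the range of the single projection
    \<open>E (x + 1)\<close>.\<close>
  have "s n \<le> x + 1" for n
  proof -
    have "1 / real (Suc n) \<le> 1" by simp
    then show ?thesis using s(1)[of n] by linarith
  qed
  then obtain l r where r: "strict_mono (r :: nat \<Rightarrow> nat)" and l: "(\<lambda>n. u (r n)) \<longlonglongrightarrow> l"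
    using cutoff_compact[of "x + 1" u] u1 s(2) by metis
  have El: "E t l = l" if t: "x < t" for t
  proof -
    obtain N where N: "1 / real (Suc N) < t - x"
      using reals_Archimedean[of "t - x"] t by (auto simp: divide_inverse)
    have "E t (u (r n)) = u (r n)" if "n \<ge> N" for n
    proof (rule u1)
      have "N \<le> r n" using seq_suble[OF r, of n] that by simp
      then have "1 / real (Suc (r n)) \<le> 1 / real (Suc N)" by (simp add: frac_le)
      then show "s (r n) \<le> t" using s(1)[of "r n"] N by linarith
    qed
    then have "(\<lambda>n. E t (u (r n))) \<longlonglongrightarrow> l"
      by (intro Lim_transform_eventually[OF l] eventually_sequentiallyI[of N]) simp
    then show ?thesis using tendsto_E[OF l] LIMSEQ_unique by blast
  qed
  have "((\<lambda>t. E t l) \<longlongrightarrow> l) (at_right x)"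
    by (rule tendsto_eventually) (auto simp: eventually_at El intro!: exI[of _ 1])
  then have "E x l = l" using E_right tendsto_unique[OF trivial_limit_at_right_real] by blast
  show False
  proof (rule unit_limit_not_orthogonal[OF l])
    show "cinner (u (r n)) l = 0" for n
      using E_sym[of x "u (r n)" l] u0 \<open>E x l = l\<close> by simp
  qed (rule s)
qed

text \<open>Otherwise an orthonormal sequence would have a convergent subsequence, although its
  members are at mutual distance \<open>sqrt 2\<close>.\<close>

lemma E_not_onto:
  assumes "infinite_dimensional TYPE('a)"
  shows "\<exists>u. E R u \<noteq> u"
proof (rule ccontr)
  assume "\<not> ?thesis"
  moreover obtain e :: "nat \<Rightarrow> 'a" where e: "\<And>n. norm (e n) = 1"
    and orth: "\<And>i j. i \<noteq> j \<Longrightarrow> cinner (e i) (e j) = 0"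
    using exists_orthonormal_sequence[OF assms] by blast
  ultimately obtain l r where r: "strict_mono (r :: nat \<Rightarrow> nat)" and l: "(\<lambda>n. e (r n)) \<longlonglongrightarrow> l"
    using cutoff_compact[of R e] by blast
  from l have "Cauchy (\<lambda>n. e (r n))" by (rule LIMSEQ_imp_Cauchy)
  then obtain N where "\<And>i j. i \<ge> N \<Longrightarrow> j \<ge> N \<Longrightarrow> norm (e (r i) - e (r j)) < 1"
    using CauchyD[of _ 1] by (metis zero_less_one)
  then have "norm (e (r N) - e (r (Suc N))) < 1" by simp
  then have "(norm (e (r N) - e (r (Suc N))))\<^sup>2 < 1"
    by (simp add: abs_square_less_1)
  moreover have "r N \<noteq> r (Suc N)" using strict_monoD[OF r, of N "Suc N"] by simp
  ultimately show False using e orth by (simp add: norm_diff_sq)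
qed

text \<open>For \<open>r \<ge> 0\<close> this is the orthogonal projection onto the eigenspace for
  the eigenvalue \<open>r\<^sup>2\<close>. The \<open>Lim\<close> is a genuine limit because
  \<open>E\<close> is constant just to the left of \<open>r\<close>.\<close>

definition jump :: "real \<Rightarrow> 'a \<Rightarrow> 'a" where
  "jump r u = E r u - Lim (at_left r) (\<lambda>s. E s u)"

lemma jump_eq: "\<exists>e>0. \<forall>s\<in>{r-e<..<r}. \<forall>u. jump r u = E r u - E s u"
proof -
  obtain e where e: "e > 0" "\<forall>s\<in>{r-e<..<r}. \<forall>s'\<in>{r-e<..<r}. E s = E s'"
    using E_constant_left by blast
  have "Lim (at_left r) (\<lambda>s. E s u) = E s u" if s: "s \<in> {r-e<..<r}" for s u
  proof (rule tendsto_Lim)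
    have "eventually (\<lambda>s'. s' \<in> {r-e<..<r}) (at_left r)"
      by (rule eventually_at_left_real) (use e in simp)
    then have "eventually (\<lambda>s'. E s' u = E s u) (at_left r)"
      by eventually_elim (metis e(2) s)
    then show "((\<lambda>s. E s u) \<longlongrightarrow> E s u) (at_left r)" by (rule tendsto_eventually)
  qed simp
  then show ?thesis using e(1) by (auto simp: jump_def)
qed

text \<open>The freedom to take \<open>s\<close> beyond a prescribed \<open>t\<close> lets
  composites such as \<open>E t (jump r u)\<close> be evaluated.\<close>

lemma jump_eqE:
  assumes "t < r"
  obtains s where "t < s" "s < r" "\<And>u. jump r u = E r u - E s u"
proof -
  obtain e where e: "e > 0" "\<forall>s\<in>{r-e<..<r}. \<forall>u. jump r u = E r u - E s u"
    using jump_eq by blast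
  obtain s where "max t (r - e) < s" "s < r" using dense[of "max t (r - e)" r] assms e(1) by auto
  then show ?thesis using that e(2) by auto
qed

lemma jump_add: "jump r (u + v) = jump r u + jump r v"
  and jump_scaleC: "jump r (a *\<^sub>C u) = a *\<^sub>C jump r u"
  and jump_sym: "cinner (jump r u) v = cinner u (jump r v)"
proof -
  obtain s where "\<And>u. jump r u = E r u - E s u" using jump_eqE[of "r - 1" r] by auto
  then show "jump r (u + v) = jump r u + jump r v" "jump r (a *\<^sub>C u) = a *\<^sub>C jump r u"
    "cinner (jump r u) v = cinner u (jump r v)"
    by (simp_all add: E_add E_scaleC scaleC.diff_right cinner.diff_left cinner.diff_right E_sym)
qed

lemma E_jump: "E t (jump r u) = (if r \<le> t then jump r u else 0)"
proof (cases "r \<le> t")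
  case True
  obtain s where "s < r" "\<And>u. jump r u = E r u - E s u" using jump_eqE[of "r - 1" r] by auto
  then show ?thesis using True by (simp add: E_diff E_E min_absorb2)
next
  case False
  then obtain s where "t < s" "s < r" "\<And>u. jump r u = E r u - E s u" using jump_eqE[of t r] by auto
  then show ?thesis using False by (simp add: E_diff E_E min_absorb1)
qed

lemma jump_jump: "jump s (jump r u) = (if s = r then jump r u else 0)"
proof (cases "r < s")
  case True
  then obtain t where "r < t" "\<And>u. jump s u = E s u - E t u" using jump_eqE[of r s] by auto
  then show ?thesis using True by (simp add: E_jump)
next
  case False
  obtain t where "t < s" "\<And>u. jump s u = E s u - E t u" using jump_eqE[of "s - 1" s] by auto
  then show ?thesis using False by (simp add: E_jump)
qed

section \<open>Atoms of the spectral measures\<close>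

lemma measure_spectral_lessThan:
  assumes "s < r" "E r u - E s u = jump r u"
  shows "measure (spectral_measure E u) {..<r} = (norm (E s u))\<^sup>2"
proof -
  obtain e where e: "e > 0" "\<forall>t\<in>{r-e<..<r}. \<forall>u. jump r u = E r u - E t u"
    using jump_eq by blast
  have "eventually (\<lambda>t. (norm (E t u))\<^sup>2 = (norm (E s u))\<^sup>2) (at_left r)"
    unfolding eventually_at_left_field
  proof (intro exI[of _ "r - e"] conjI allI impI)
    fix t assume "r - e < t" "t < r"
    then have "jump r u = E r u - E t u" using e by auto
    then have "E t u = E s u" using assms(2) by (metis diff_left_imp_eq)
    then show "(norm (E t u))\<^sup>2 = (norm (E s u))\<^sup>2" by simp
  qed (use e in simp)
  then have "((\<lambda>t. (norm (E t u))\<^sup>2) \<longlongrightarrow> (norm (E s u))\<^sup>2) (at_left r)"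
    by (rule tendsto_eventually)
  then show ?thesis
    using spectral_measure.cdf_at_left[of u r] tendsto_unique[OF trivial_limit_at_left_real]
    unfolding cdf_def measure_spectral_Iic by blast
qed

lemma measure_spectral_singleton: "measure (spectral_measure E u) {r} = (norm (jump r u))\<^sup>2"
proof -
  obtain s where s: "s < r" "\<And>u. jump r u = E r u - E s u" using jump_eqE[of "r - 1" r] by auto
  have "measure (spectral_measure E u) ({..r} - {..<r})
      = measure (spectral_measure E u) {..r} - measure (spectral_measure E u) {..<r}"
    by (rule spectral_measure.finite_measure_Diff) auto
  also have "{..r} - {..<r} = {r}" by auto
  finally show ?thesis
    using s(1) norm_E_diff[of s r u] measure_spectral_lessThan[OF s(1) s(2)[symmetric]] s(2)
    by (simp add: measure_spectral_Iic)
qed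

text \<open>One neighbourhood serves every \<open>u\<close>, because local constancy concerns the
  operators \<open>E s\<close> themselves.\<close>

lemma exists_null_neighbourhood:
  "\<exists>U. open U \<and> x \<in> U \<and> (\<forall>u. U - {x} \<in> null_sets (spectral_measure E u)) \<and>
    (\<forall>y\<in>U - {x}. \<forall>u. jump y u = 0)"
proof -
  obtain e1 where e1: "e1 > 0" "\<forall>s\<in>{x-e1<..<x}. \<forall>s'\<in>{x-e1<..<x}. E s = E s'"
    using E_constant_left by blast
  obtain e2 where e2: "e2 > 0" "\<forall>s\<in>{x..<x+e2}. E s = E x"
    using E_constant_right by blast
  obtain s where s: "x - e1 < s" "s < x" "\<And>u. jump x u = E x u - E s u"
    using jump_eqE[of "x - e1" x] e1(1) by auto
  define t where "t = x + e2 / 2"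
  have "x < t" "t \<in> {x..<x + e2}" using e2(1) by (auto simp: t_def)
  then have t: "x < t" "E t = E x" using e2(2) by blast+
  have null: "{s<..<t} - {x} \<in> null_sets (spectral_measure E u)" for u
  proof -
    have "measure (spectral_measure E u) ({..<x} - {..s})
        = measure (spectral_measure E u) {..<x} - measure (spectral_measure E u) {..s}"
      by (rule spectral_measure.finite_measure_Diff) (use s in auto)
    then have "measure (spectral_measure E u) ({..<x} - {..s}) = 0"
      using measure_spectral_lessThan[OF s(2) s(3)[symmetric]] by (simp add: measure_spectral_Iic)
    moreover have "measure (spectral_measure E u) ({..t} - {..x}) = 0"
      using t by (subst spectral_measure.finite_measure_Diff) (auto simp: measure_spectral_Iic)
    ultimately have "({..<x} - {..s}) \<union> ({..t} - {..x}) \<in> null_sets (spectral_measure E u)"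
      by (intro null_sets.Un) (auto simp: null_sets_def spectral_measure.emeasure_eq_measure)
    then show ?thesis by (rule null_sets_subset) auto
  qed
  moreover have "jump y u = 0" if "y \<in> {s<..<t} - {x}" for y u
  proof -
    have "measure (spectral_measure E u) {y} = 0"
      using null_sets_subset[OF null, of "{y}" u] that
      by (auto simp: null_sets_def measure_def)
    then show ?thesis by (simp add: measure_spectral_singleton)
  qed
  ultimately show ?thesis using s(2) t(1) by (intro exI[of _ "{s<..<t}"]) auto
qed

text \<open>Lindelof's theorem reduces the cover by the neighbourhoods above to countably many
  centres. Every jump is one of these centres, and the part of each neighbourhood off the jumps is a
  null set.\<close>

lemma countable_jumps: "countable {r. \<exists>u. jump r u \<noteq> 0}" (is "countable ?J")
  and jumps_full: "- {r. \<exists>u. jump r u \<noteq> 0} \<in> null_sets (spectral_measure E u)"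
proof -
  obtain U where U: "\<And>x. open (U x)" "\<And>x. x \<in> U x"
    "\<And>x u. U x - {x} \<in> null_sets (spectral_measure E u)"
    "\<And>x y u. y \<in> U x \<Longrightarrow> y \<noteq> x \<Longrightarrow> jump y u = 0"
    using exists_null_neighbourhood by (metis DiffI singletonD)
  obtain F where F: "F \<subseteq> range U" "countable F" "\<Union>F = \<Union>(range U)"
    using Lindelof[of "range U"] U(1) by auto
  obtain X where X: "countable X" "F = U ` X"
    using F(1,2) by (metis countable_subset_image top_greatest subset_UNIV)
  have cover: "(\<Union>x\<in>X. U x) = UNIV" using F(3) X(2) U(2) by auto
  have "?J \<subseteq> X" using cover U(4) by blast
  then show J: "countable ?J" using X(1) countable_subset by blast
  have "- ?J \<inter> U x \<in> null_sets (spectral_measure E u)" for x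
  proof -
    have "(U x - {x}) \<union> ({x} - ?J) \<in> null_sets (spectral_measure E u)"
    proof (rule null_sets.Un[OF U(3)])
      show "{x} - ?J \<in> null_sets (spectral_measure E u)"
      proof (cases "x \<in> ?J")
        case False
        then have "{x} - ?J = {x}" "jump x u = 0" by auto
        then show ?thesis
          using measure_spectral_singleton[of u x]
          by (simp add: null_sets_def spectral_measure.emeasure_eq_measure)
      next
        case True
        then have "{x} - ?J = {}" by blast
        then show ?thesis by (simp only: null_sets.empty_sets)
      qed
    qed
    moreover have "?J \<in> sets borel" by (rule sets.countable) (use J in auto)
    ultimately show ?thesis
      using U(1) by (elim null_sets_subset) (auto intro!: sets.Int)
  qed
  then have "(\<Union>x\<in>X. - ?J \<inter> U x) \<in> null_sets (spectral_measure E u)"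
    using X(1) by (intro null_sets_UN') auto
  moreover have "(\<Union>x\<in>X. - ?J \<inter> U x) = - ?J" using cover by blast
  ultimately show "- ?J \<in> null_sets (spectral_measure E u)" by simp
qed

text \<open>Without jumps beyond \<open>R\<close> no vector has spectral mass there, so
  \<open>E R\<close> would be the identity.\<close>

lemma jumps_unbounded:
  assumes "infinite_dimensional TYPE('a)"
  shows "\<exists>r>R. \<exists>u. jump r u \<noteq> 0"
proof (rule ccontr)
  assume "\<not> ?thesis"
  then have "{R<..} \<subseteq> - {r. \<exists>u. jump r u \<noteq> 0}" by auto
  then have "measure (spectral_measure E u) {R<..} = 0" for u
    using null_sets_subset[OF jumps_full[of u], of "{R<..}"] by (auto simp: null_sets_def measure_def)
  then have "E R u = u" for u by (simp add: measure_spectral_Ioi)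
  then show False using E_not_onto[OF assms] by blast
qed

text \<open>The identity map in \<open>distr\<close> only changes the sigma-algebra, from the power
  set to the Borel sets.\<close>

lemma spectral_measure_atomic:
  "spectral_measure E u = distr (density (count_space UNIV) (\<lambda>r. ennreal ((norm (jump r u))\<^sup>2))) borel (\<lambda>r. r)"
proof (rule measure_eqI)
  let ?J = "{r. \<exists>u. jump r u \<noteq> 0}"
  fix A assume "A \<in> sets (spectral_measure E u)"
  then have A: "A \<in> sets borel" by simp
  have J: "?J \<in> sets borel" by (rule sets.countable) (use countable_jumps in auto)
  have "A - ?J \<in> null_sets (spectral_measure E u)"
    by (rule null_sets_subset[OF jumps_full[of u]]) (use A J in auto)
  then have "emeasure (spectral_measure E u) A = emeasure (spectral_measure E u) (A \<inter> ?J)"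
    using emeasure_Un_null_set[of "A \<inter> ?J" "spectral_measure E u" "A - ?J"] A J
    by (simp add: Int_Diff_Un)
  also have "\<dots> = (\<integral>\<^sup>+r. emeasure (spectral_measure E u) {r} \<partial>count_space (A \<inter> ?J))"
    by (rule emeasure_countable_singleton) (auto intro: countable_Int2 countable_jumps)
  also have "\<dots> = (\<integral>\<^sup>+r. ennreal ((norm (jump r u))\<^sup>2) \<partial>count_space (A \<inter> ?J))"
    by (simp add: spectral_measure.emeasure_eq_measure measure_spectral_singleton)
  also have "\<dots> = (\<integral>\<^sup>+r. ennreal ((norm (jump r u))\<^sup>2) * indicator A r \<partial>count_space UNIV)"
    by (auto simp: nn_integral_count_space_indicator indicator_def intro!: nn_integral_cong)
  also have "\<dots> = emeasure (distr (density (count_space UNIV) (\<lambda>r. ennreal ((norm (jump r u))\<^sup>2))) borel (\<lambda>r. r)) A"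
    using A by (simp add: emeasure_distr emeasure_density)
  finally show "emeasure (spectral_measure E u) A = \<dots>" .
qed simp

lemma integrable_spectral_iff:
  fixes g :: "real \<Rightarrow> real"
  assumes [measurable]: "g \<in> borel_measurable borel"
  shows "integrable (spectral_measure E u) g \<longleftrightarrow>
    integrable (count_space UNIV) (\<lambda>r. g r * (norm (jump r u))\<^sup>2)"
  unfolding spectral_measure_atomic
  by (subst integrable_distr_eq) (simp_all add: integrable_density mult.commute)

lemma integral_spectral:
  fixes g :: "real \<Rightarrow> real"
  assumes [measurable]: "g \<in> borel_measurable borel"
  shows "(\<integral>r. g r \<partial>spectral_measure E u) = (\<integral>r. g r * (norm (jump r u))\<^sup>2 \<partial>count_space UNIV)"
  unfolding spectral_measure_atomic
  by (subst integral_distr) (simp_all add: integral_density mult.commute)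

section \<open>Functional calculus\<close>

lemma jump_diff: "jump r (u - v) = jump r u - jump r v"
  using jump_add[of r "u - v" v] by simp

lemma jump_scaleR: "jump r (a *\<^sub>R u) = a *\<^sub>R jump r u"
  by (metis jump_scaleC scaleC_of_real)

lemma integrable_norm_jump: "integrable (count_space UNIV) (\<lambda>r. (norm (jump r u))\<^sup>2)"
  using integrable_spectral_iff[of "\<lambda>_. 1" u] by simp

lemma integral_norm_jump: "(\<integral>r. (norm (jump r u))\<^sup>2 \<partial>count_space UNIV) = (norm u)\<^sup>2"
  using integral_spectral[of "\<lambda>_. 1" u] by (simp add: measure_spectral_UNIV)

lemma jump_eqI:
  assumes "\<And>r. jump r u = jump r v"
  shows "u = v"
  using integral_norm_jump[of "u - v"] assms by (simp add: jump_diff)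

text \<open>Polarisation term by term. Integrability over \<open>count_space UNIV\<close> expresses
  absolute summability over all real \<open>r\<close>.\<close>

lemma spectral_integral_eq_sum:
  assumes [measurable]: "(\<lambda>r. f (r\<^sup>2)) \<in> borel_measurable borel"
    and "integrable (count_space UNIV) (\<lambda>r. f (r\<^sup>2) * (norm (jump r u))\<^sup>2)"
    and "integrable (count_space UNIV) (\<lambda>r. f (r\<^sup>2) * (norm (jump r v))\<^sup>2)"
  shows "integrable (count_space UNIV) (\<lambda>r. f (r\<^sup>2) *\<^sub>R cinner (jump r u) (jump r v))" (is ?int)
    and "spectral_integral E f u v = (\<integral>r. f (r\<^sup>2) *\<^sub>R cinner (jump r u) (jump r v) \<partial>count_space UNIV)"
      (is "_ = ?I")
proof -
  define g where "g k r = f (r\<^sup>2) * (norm (jump r (u + \<i> ^ k *\<^sub>C v)))\<^sup>2" for k :: nat and r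
  have int: "integrable (count_space UNIV) (g k)" for k
  proof (rule Bochner_Integration.integrable_bound[of _ "\<lambda>r. 2 * (f (r\<^sup>2) * (norm (jump r u))\<^sup>2)
      + 2 * (f (r\<^sup>2) * (norm (jump r v))\<^sup>2)"])
    have "norm (g k r) \<le> norm (2 * (f (r\<^sup>2) * (norm (jump r u))\<^sup>2) + 2 * (f (r\<^sup>2) * (norm (jump r v))\<^sup>2))" for r
    proof -
      have "norm (g k r) \<le> \<bar>f (r\<^sup>2)\<bar> * (2 * (norm (jump r u))\<^sup>2 + 2 * (norm (jump r v))\<^sup>2)"
        using norm_add_sq_le[of "jump r u" "\<i> ^ k *\<^sub>C jump r v"]
        by (auto simp: g_def abs_mult jump_add jump_scaleC norm_scaleC norm_power intro!: mult_left_mono)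
      also have "\<dots> = \<bar>f (r\<^sup>2) * (2 * (norm (jump r u))\<^sup>2 + 2 * (norm (jump r v))\<^sup>2)\<bar>"
        unfolding abs_mult by simp
      also have "\<dots> = norm (2 * (f (r\<^sup>2) * (norm (jump r u))\<^sup>2) + 2 * (f (r\<^sup>2) * (norm (jump r v))\<^sup>2))"
        by (simp add: algebra_simps)
      finally show ?thesis .
    qed
    then show "AE r in count_space UNIV. norm (g k r)
      \<le> norm (2 * (f (r\<^sup>2) * (norm (jump r u))\<^sup>2) + 2 * (f (r\<^sup>2) * (norm (jump r v))\<^sup>2))" by simp
  qed (use assms in auto)
  have pointwise: "f (r\<^sup>2) *\<^sub>R cinner (jump r u) (jump r v)
      = (\<Sum>k<4. \<i> ^ k * complex_of_real (g k r)) / 4" for r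
    unfolding polarization[of "jump r u" "jump r v", symmetric]
    by (simp add: g_def jump_add jump_scaleC scaleR_conv_of_real sum_distrib_left sum_divide_distrib
        mult_ac)
  show ?int unfolding pointwise using int by (intro integrable_divide) auto
  have "spectral_integral E f u v
      = (\<Sum>k<4. \<i> ^ k * (\<integral>r. complex_of_real (g k r) \<partial>count_space UNIV)) / 4"
    by (simp add: spectral_integral_def integral_spectral flip: g_def)
  also have "\<dots> = ?I" unfolding pointwise using int by simp
  finally show "spectral_integral E f u v = ?I" .
qed

text \<open>The case \<open>f = 1\<close>, in which \<open>polarization\<close> evaluates the
  spectral integral directly.\<close>

lemma integrable_cinner_jump: "integrable (count_space UNIV) (\<lambda>r. cinner (jump r u) (jump r v))"
  and integral_cinner_jump: "(\<integral>r. cinner (jump r u) (jump r v) \<partial>count_space UNIV) = cinner u v"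
proof -
  have "spectral_integral E (\<lambda>_. 1) u v = cinner u v"
    by (simp add: spectral_integral_def measure_spectral_UNIV polarization del: of_real_power)
  then show "integrable (count_space UNIV) (\<lambda>r. cinner (jump r u) (jump r v))"
    "(\<integral>r. cinner (jump r u) (jump r v) \<partial>count_space UNIV) = cinner u v"
    using spectral_integral_eq_sum[of "\<lambda>_. 1" u v] by (simp_all add: integrable_norm_jump)
qed

text \<open>The vector is the Riesz representative of \<open>phi\<close>, the formal pairing of
  \<open>v\<close> with the series of all \<open>c r *\<^sub>R jump r u\<close>; the series itself
  is never summed in \<open>H\<close>.\<close>

lemma exists_multiplier:
  fixes c :: "real \<Rightarrow> real"
  assumes "integrable (count_space UNIV) (\<lambda>r. (c r)\<^sup>2 * (norm (jump r u))\<^sup>2)"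
  shows "\<exists>w. \<forall>r. jump r w = c r *\<^sub>R jump r u"
proof -
  define g where "g v r = c r *\<^sub>R cinner (jump r v) (jump r u)" for v r
  define phi where "phi v = (\<integral>r. g v r \<partial>count_space UNIV)" for v
  have g_le: "cmod (g v r) \<le> (c r)\<^sup>2 * (norm (jump r u))\<^sup>2 + (norm (jump r v))\<^sup>2" for v r
  proof -
    have "cmod (g v r) \<le> \<bar>c r\<bar> * (norm (jump r v) * norm (jump r u))"
      by (simp add: g_def mult_left_mono Cauchy_Schwarz_cinner)
    also have "\<dots> = (\<bar>c r\<bar> * norm (jump r u)) * norm (jump r v)" by simp
    also have "\<dots> \<le> (\<bar>c r\<bar> * norm (jump r u))\<^sup>2 + (norm (jump r v))\<^sup>2"
    proof -
      have "a * b \<le> a\<^sup>2 + b\<^sup>2" if "0 \<le> a" "0 \<le> b" for a b :: real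
        using sum_squares_bound[of a b] mult_nonneg_nonneg[OF that] by linarith
      then show ?thesis by simp
    qed
    finally show ?thesis by (simp add: power_mult_distrib)
  qed
  have int_bound: "integrable (count_space UNIV) (\<lambda>r. (c r)\<^sup>2 * (norm (jump r u))\<^sup>2 + (norm (jump r v))\<^sup>2)" for v
    using assms integrable_norm_jump by (rule Bochner_Integration.integrable_add)
  have int: "integrable (count_space UNIV) (g v)" for v
    by (rule Bochner_Integration.integrable_bound[OF int_bound[of v]])
       (use g_le in \<open>auto intro: order_trans[OF _ abs_ge_self]\<close>)
  define A where "A = (\<integral>r. (c r)\<^sup>2 * (norm (jump r u))\<^sup>2 \<partial>count_space UNIV)"
  have phi_le: "cmod (phi v) \<le> A + (norm v)\<^sup>2" for v
  proof -
    have "cmod (phi v) \<le> (\<integral>r. cmod (g v r) \<partial>count_space UNIV)" unfolding phi_def by simp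
    also have "\<dots> \<le> (\<integral>r. (c r)\<^sup>2 * (norm (jump r u))\<^sup>2 + (norm (jump r v))\<^sup>2 \<partial>count_space UNIV)"
      by (rule integral_mono) (use int int_bound g_le in auto)
    also have "\<dots> = A + (norm v)\<^sup>2"
      using assms integrable_norm_jump by (simp add: A_def integral_norm_jump)
    finally show ?thesis .
  qed
  have phi_scale: "phi (a *\<^sub>C v) = a * phi v" for a v
  proof -
    have "g (a *\<^sub>C v) = (\<lambda>r. a * g v r)"
      by (simp add: g_def jump_scaleC cinner_scaleC_left fun_eq_iff)
    then show ?thesis unfolding phi_def by simp
  qed
  have "\<exists>w. \<forall>v. phi v = cinner v w"
  proof (rule Riesz_representation)
    show "phi (v + w) = phi v + phi w" for v w
    proof -
      have "g (v + w) = (\<lambda>r. g v r + g w r)"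
        by (simp add: g_def jump_add cinner_add_left scaleR_add_right fun_eq_iff)
      then show ?thesis unfolding phi_def using int by simp
    qed
    \<comment> \<open>The estimate \<open>phi_le\<close> is not homogeneous; applied to the unit
      vector in the direction of \<open>v\<close> and scaled back, it becomes linear in
      \<open>norm v\<close>.\<close>
    show "cmod (phi v) \<le> (A + 1) * norm v" for v
    proof (cases "v = 0")
      case True
      then show ?thesis using phi_scale[of 0 v] by simp
    next
      case False
      have "cmod (phi v) = cmod (phi (complex_of_real (norm v) *\<^sub>C ((1 / norm v) *\<^sub>R v)))"
        using False by (simp add: scaleC_of_real)
      also have "\<dots> = norm v * cmod (phi ((1 / norm v) *\<^sub>R v))"
        unfolding phi_scale by (simp add: norm_mult)
      also have "\<dots> \<le> norm v * (A + 1)"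
        using phi_le[of "(1 / norm v) *\<^sub>R v"] False by (intro mult_left_mono) auto
      finally show ?thesis by (simp add: mult.commute)
    qed
  qed (rule phi_scale)
  then obtain w where w: "phi v = cinner v w" for v by blast
  have "jump s w = c s *\<^sub>R jump s u" for s
  proof (rule cinner_eqI)
    fix v
    \<comment> \<open>Testing against \<open>jump s v\<close> isolates the single term
      \<open>r = s\<close>.\<close>
    have supp: "g (jump s v) = (\<lambda>r. if r = s then g v s else 0)"
      by (auto simp: g_def jump_jump fun_eq_iff)
    have "cinner v (jump s w) = phi (jump s v)"
      by (simp add: w jump_sym)
    also have "\<dots> = g v s"
    proof -
      have "{a \<in> UNIV. (if a = s then g v s else 0) \<noteq> 0} = (if g v s = 0 then {} else {s})" by auto
      then show ?thesis
        unfolding phi_def supp by (subst lebesgue_integral_count_space_finite_support) auto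
    qed
    also have "\<dots> = cinner v (c s *\<^sub>R jump s u)"
      by (simp add: g_def cinner_scaleR_right jump_sym jump_jump)
    finally show "cinner (jump s w) v = cinner (c s *\<^sub>R jump s u) v"
      by (metis cinner_commute)
  qed
  then show ?thesis by blast
qed

lemma exists_bounded_multiplier:
  assumes "\<And>r. \<bar>c r\<bar> \<le> B"
  shows "\<exists>w. \<forall>r. jump r w = c r *\<^sub>R jump r u"
proof (rule exists_multiplier, rule Bochner_Integration.integrable_bound)
  have "(c r)\<^sup>2 \<le> B\<^sup>2" for r using assms[of r] by (metis abs_ge_zero power2_abs power_mono)
  then show "AE r in count_space UNIV. norm ((c r)\<^sup>2 * (norm (jump r u))\<^sup>2) \<le> norm (B\<^sup>2 * (norm (jump r u))\<^sup>2)"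
    by (auto intro!: mult_right_mono)
qed (auto intro: integrable_norm_jump)

lemma norm_multiplier_le:
  assumes "\<And>r. jump r w = c r *\<^sub>R jump r u" "\<And>r. \<bar>c r\<bar> \<le> B"
  shows "norm w \<le> B * norm u"
proof (rule power2_le_imp_le)
  have "(norm (jump r w))\<^sup>2 \<le> B\<^sup>2 * (norm (jump r u))\<^sup>2" for r
    using power_mono[OF assms(2) abs_ge_zero, of r 2] by (auto simp: assms(1) power_mult_distrib intro!: mult_right_mono)
  then have "(\<integral>r. (norm (jump r w))\<^sup>2 \<partial>count_space UNIV)
      \<le> (\<integral>r. B\<^sup>2 * (norm (jump r u))\<^sup>2 \<partial>count_space UNIV)"
    by (intro integral_mono integrable_norm_jump integrable_mult_right)
  then show "(norm w)\<^sup>2 \<le> (B * norm u)\<^sup>2" by (simp add: integral_norm_jump power_mult_distrib)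
  show "0 \<le> B * norm u" using order_trans[OF abs_ge_zero assms(2)] by simp
qed

lemma fdom_iff:
  "u \<in> fdom E f \<longleftrightarrow> (\<lambda>r. f (r\<^sup>2)) \<in> borel_measurable borel \<and>
    integrable (count_space UNIV) (\<lambda>r. (f (r\<^sup>2))\<^sup>2 * (norm (jump r u))\<^sup>2)"
  by (auto simp: fdom_def integrable_spectral_iff)

lemma fdomI:
  assumes "(\<lambda>r. f (r\<^sup>2)) \<in> borel_measurable borel" "\<And>r. jump r w = f (r\<^sup>2) *\<^sub>R jump r u"
  shows "u \<in> fdom E f"
  using integrable_norm_jump[of w] assms by (simp add: fdom_iff power_mult_distrib)

lemma fdom_integrable:
  assumes "u \<in> fdom E f"
  shows "integrable (count_space UNIV) (\<lambda>r. f (r\<^sup>2) * (norm (jump r u))\<^sup>2)"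
proof (rule Bochner_Integration.integrable_bound)
  show "integrable (count_space UNIV) (\<lambda>r. (f (r\<^sup>2))\<^sup>2 * (norm (jump r u))\<^sup>2 + (norm (jump r u))\<^sup>2)"
    using assms by (intro Bochner_Integration.integrable_add integrable_norm_jump) (simp add: fdom_iff)
  have "\<bar>x\<bar> \<le> x\<^sup>2 + 1" for x :: real
    using zero_le_power2[of "\<bar>x\<bar> - 1"] unfolding power2_diff by simp
  then have "\<bar>x\<bar> * y\<^sup>2 \<le> x\<^sup>2 * y\<^sup>2 + y\<^sup>2" for x y :: real
    using mult_right_mono[of "\<bar>x\<bar>" "x\<^sup>2 + 1" "y\<^sup>2"] by (simp add: algebra_simps)
  then show "AE r in count_space UNIV. norm (f (r\<^sup>2) * (norm (jump r u))\<^sup>2)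
      \<le> norm ((f (r\<^sup>2))\<^sup>2 * (norm (jump r u))\<^sup>2 + (norm (jump r u))\<^sup>2)"
    by (auto simp: abs_mult)
qed simp

text \<open>Reduces the calculus to coefficients on jumps. The existence of \<open>w\<close> already
  puts \<open>u\<close> in the domain, and the description is unique because every
  \<open>jump s v\<close> is an admissible test vector.\<close>

lemma fcalc_eqI:
  assumes meas: "(\<lambda>r. f (r\<^sup>2)) \<in> borel_measurable borel"
    and jump: "\<And>r. jump r w = f (r\<^sup>2) *\<^sub>R jump r u"
  shows "fcalc E f u = w"
  unfolding fcalc_def
proof (rule the_equality)
  have u: "u \<in> fdom E f" using meas jump by (rule fdomI)
  have eq: "cinner w v = spectral_integral E f u v" if "v \<in> fdom E f" for v
    using integral_cinner_jump[of w v]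
      spectral_integral_eq_sum(2)[OF meas fdom_integrable[OF u] fdom_integrable[OF that]]
    by (simp add: jump cinner_scaleR_left)
  then show "\<forall>v\<in>fdom E f. cinner w v = spectral_integral E f u v" by blast
  fix w' assume w': "\<forall>v\<in>fdom E f. cinner w' v = spectral_integral E f u v"
  show "w' = w"
  proof (rule jump_eqI, rule cinner_eqI)
    fix s v
    have "jump s v \<in> fdom E f"
      by (rule fdomI[OF meas, of "f (s\<^sup>2) *\<^sub>R jump s v"]) (auto simp: jump_scaleR jump_jump)
    then show "cinner (jump s w') v = cinner (jump s w) v"
      using w' eq by (simp add: jump_sym)
  qed
qed

lemma jump_fcalc: "u \<in> fdom E f \<Longrightarrow> jump r (fcalc E f u) = f (r\<^sup>2) *\<^sub>R jump r u"
  using exists_multiplier[of "\<lambda>r. f (r\<^sup>2)" u] fcalc_eqI[of f _ u] by (auto simp: fdom_iff)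

section \<open>The energy space\<close>

lemma one_plus_sq_pos [simp]: "0 < 1 + r\<^sup>2" for r :: real
  by (simp add: add_pos_nonneg)

lemma one_plus_sq_neq_0 [simp]: "1 + r\<^sup>2 \<noteq> 0" for r :: real
  using one_plus_sq_pos[of r] by linarith

text \<open>Solve \<open>u = (1 + P)^(-1/2) v\<close> jump by jump; the witness \<open>v\<close> is
  \<open>(1 + P)^(1/2) u\<close>.\<close>

lemma H_half_iff: "u \<in> H_half E \<longleftrightarrow> (\<exists>v. \<forall>r. jump r v = sqrt (1 + r\<^sup>2) *\<^sub>R jump r u)"
proof -
  let ?f = "\<lambda>x::real. (1 + x) powr (- (1 / 2))"
  have f: "?f (r\<^sup>2) = 1 / sqrt (1 + r\<^sup>2)" for r
    using powr_minus_half[of "1 + r\<^sup>2"] by simp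
  have meas: "(\<lambda>r. ?f (r\<^sup>2)) \<in> borel_measurable borel" by measurable
  have iff: "u = fcalc E ?f v \<longleftrightarrow> (\<forall>r. jump r v = sqrt (1 + r\<^sup>2) *\<^sub>R jump r u)" for v
  proof -
    obtain w where "\<forall>r. jump r w = (1 / sqrt (1 + r\<^sup>2)) *\<^sub>R jump r v"
      using exists_bounded_multiplier[of "\<lambda>r. 1 / sqrt (1 + r\<^sup>2)" 1 v] by auto
    then have w: "jump r w = ?f (r\<^sup>2) *\<^sub>R jump r v" for r by (simp add: f)
    have "fcalc E ?f v = w" by (rule fcalc_eqI[OF meas w])
    moreover have "u = w \<longleftrightarrow> (\<forall>r. jump r u = jump r w)" using jump_eqI by blast
    moreover have "jump r u = jump r w \<longleftrightarrow> jump r v = sqrt (1 + r\<^sup>2) *\<^sub>R jump r u" for r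
      unfolding w f by auto
    ultimately show ?thesis by metis
  qed
  have "u \<in> H_half E \<longleftrightarrow> (\<exists>v. u = fcalc E ?f v)" unfolding sobolev_def by auto
  then show ?thesis unfolding iff .
qed

lemma H_halfE:
  assumes "u \<in> H_half E"
  obtains v where "\<And>r. jump r v = sqrt (1 + r\<^sup>2) *\<^sub>R jump r u"
  using assms unfolding H_half_iff by blast

lemma sobolev_norm_half_eq:
  assumes "\<And>r. jump r v = sqrt (1 + r\<^sup>2) *\<^sub>R jump r u"
  shows "sobolev_norm E (1/2) u = norm v"
proof -
  have "fcalc E (\<lambda>x. (1 + x) powr (1/2)) u = v"
    by (rule fcalc_eqI) (auto simp: powr_half_sqrt assms)
  then show ?thesis by (simp add: sobolev_norm_def)
qed

lemma jump_in_H_half: "jump s u \<in> H_half E"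
  unfolding H_half_iff
  by (rule exI[of _ "sqrt (1 + s\<^sup>2) *\<^sub>R jump s u"]) (auto simp: jump_scaleR jump_jump)

text \<open>The eigenvectors lie in \<open>H_half E\<close> and already separate points.\<close>

lemma H_half_separating:
  assumes "\<And>w. w \<in> H_half E \<Longrightarrow> cinner h w = cinner h' w"
  shows "h = h'"
proof (rule jump_eqI, rule cinner_eqI)
  show "cinner (jump s h) v = cinner (jump s h') v" for s v
    using assms[OF jump_in_H_half] by (simp add: jump_sym)
qed

lemma P_ext_eq_sum:
  assumes "u \<in> H_half E" "w \<in> H_half E"
  shows "integrable (count_space UNIV) (\<lambda>r. r\<^sup>2 *\<^sub>R cinner (jump r u) (jump r w))"
    and "P_ext E u w = (\<integral>r. r\<^sup>2 *\<^sub>R cinner (jump r u) (jump r w) \<partial>count_space UNIV)"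
proof -
  have int: "integrable (count_space UNIV) (\<lambda>r. r\<^sup>2 * (norm (jump r y))\<^sup>2)" if y: "y \<in> H_half E" for y
  proof -
    obtain v where v: "\<And>r. jump r v = sqrt (1 + r\<^sup>2) *\<^sub>R jump r y"
      using H_halfE[OF y] by blast
    show ?thesis
      by (rule Bochner_Integration.integrable_bound[OF integrable_norm_jump[of v]])
         (auto simp: v power_mult_distrib intro!: mult_right_mono)
  qed
  show "integrable (count_space UNIV) (\<lambda>r. r\<^sup>2 *\<^sub>R cinner (jump r u) (jump r w))"
    "P_ext E u w = (\<integral>r. r\<^sup>2 *\<^sub>R cinner (jump r u) (jump r w) \<partial>count_space UNIV)"
    unfolding P_ext_def using spectral_integral_eq_sum[of "\<lambda>x. x" u w] int assms by auto
qed

lemma fcalc_resolvent_half: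
  assumes "0 < l"
  shows "jump r (fcalc E (\<lambda>x. (1 + x / l\<^sup>2) powr (- 1 / 2)) v) = (l / sqrt (l\<^sup>2 + r\<^sup>2)) *\<^sub>R jump r v"
proof -
  let ?g = "\<lambda>x::real. (1 + x / l\<^sup>2) powr (- 1 / 2)"
  have g: "?g (r\<^sup>2) = l / sqrt (l\<^sup>2 + r\<^sup>2)" for r
  proof -
    have "1 + r\<^sup>2 / l\<^sup>2 = (l\<^sup>2 + r\<^sup>2) / l\<^sup>2" using assms by (simp add: field_simps)
    moreover have "0 < 1 + r\<^sup>2 / l\<^sup>2" by (simp add: add_pos_nonneg)
    ultimately show ?thesis using assms powr_minus_half[of "1 + r\<^sup>2 / l\<^sup>2"]
      by (simp add: real_sqrt_divide)
  qed
  have c: "\<bar>l / sqrt (l\<^sup>2 + r\<^sup>2)\<bar> \<le> 1" for r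
  proof -
    have "sqrt (l\<^sup>2) \<le> sqrt (l\<^sup>2 + r\<^sup>2)" by (intro real_sqrt_le_mono) simp
    then have "l \<le> sqrt (l\<^sup>2 + r\<^sup>2)" using assms by simp
    then have "l / sqrt (l\<^sup>2 + r\<^sup>2) \<le> 1" using assms by (intro divide_le_eq_1_pos[THEN iffD2]) linarith+
    then show ?thesis using assms by simp
  qed
  obtain w where w: "\<And>r. jump r w = (l / sqrt (l\<^sup>2 + r\<^sup>2)) *\<^sub>R jump r v"
    using exists_bounded_multiplier[of "\<lambda>r. l / sqrt (l\<^sup>2 + r\<^sup>2)", OF c] by blast
  have "fcalc E ?g v = w"
    by (rule fcalc_eqI) (measurable, use w g in simp)
  then show ?thesis using w by simp
qed

section \<open>Resolvent estimate\<close>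

text \<open>The coefficients of \<open>(1 + P)^(1/2) G\<close> are at most \<open>l\<close> because
  \<open>l \<ge> 1\<close>, so \<open>Q\<close> after \<open>G\<close> is bounded on
  \<open>H\<close>. Riesz representation then shows that the definite description in
  \<open>fcalc_dual\<close> has a value.\<close>

lemma fcalc_dual_Q_adj:
  assumes Q: "bounded_observation E Q" and l: "1 \<le> l"
  defines "g \<equiv> \<lambda>x. (1 + x / l\<^sup>2) powr (- 1 / 2)"
  shows "cinner (fcalc_dual E g (Q_adj Q y)) v = cinner y (Q (fcalc E g v))"
proof -
  obtain K where K: "\<And>u. u \<in> H_half E \<Longrightarrow> norm (Q u) \<le> K * sobolev_norm E (1/2) u"
    and lin: "clinear_on (H_half E) Q"
    using Q unfolding bounded_observation_def by blast
  define G where "G = fcalc E g"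
  have l0: "0 < l" using l by simp
  have G: "jump r (G v) = (l / sqrt (l\<^sup>2 + r\<^sup>2)) *\<^sub>R jump r v" for r v
    unfolding G_def g_def by (rule fcalc_resolvent_half[OF l0])
  have c: "\<bar>sqrt (1 + r\<^sup>2) * (l / sqrt (l\<^sup>2 + r\<^sup>2))\<bar> \<le> l" for r
  proof -
    have "sqrt (1 + r\<^sup>2) \<le> sqrt (l\<^sup>2 + r\<^sup>2)" using l by (intro real_sqrt_le_mono) simp
    moreover have "0 < sqrt (l\<^sup>2 + r\<^sup>2)" using l0 by (simp add: add_pos_nonneg)
    ultimately have "sqrt (1 + r\<^sup>2) / sqrt (l\<^sup>2 + r\<^sup>2) \<le> 1" by simp
    then have "sqrt (1 + r\<^sup>2) / sqrt (l\<^sup>2 + r\<^sup>2) * l \<le> 1 * l" using l0 by (intro mult_right_mono) auto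
    then show ?thesis using l0 by (simp add: abs_mult)
  qed
  have G_H: "G v \<in> H_half E" "norm (Q (G v)) \<le> \<bar>K\<bar> * l * norm v" for v
  proof -
    obtain w where w: "\<And>r. jump r w = (sqrt (1 + r\<^sup>2) * (l / sqrt (l\<^sup>2 + r\<^sup>2))) *\<^sub>R jump r v"
      using exists_bounded_multiplier[of "\<lambda>r. sqrt (1 + r\<^sup>2) * (l / sqrt (l\<^sup>2 + r\<^sup>2))", OF c] by blast
    then have w': "jump r w = sqrt (1 + r\<^sup>2) *\<^sub>R jump r (G v)" for r by (simp add: G)
    then show "G v \<in> H_half E" unfolding H_half_iff by blast
    then have "norm (Q (G v)) \<le> K * norm w" using K[of "G v"] sobolev_norm_half_eq[OF w'] by simp
    also have "\<dots> \<le> \<bar>K\<bar> * (l * norm v)"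
      by (intro mult_mono norm_multiplier_le[OF w c]) auto
    finally show "norm (Q (G v)) \<le> \<bar>K\<bar> * l * norm v" by simp
  qed
  have G_add: "G (v + w) = G v + G w" and G_scale: "G (a *\<^sub>C v) = a *\<^sub>C G v" for v w a
    by (rule jump_eqI; simp add: G jump_add jump_scaleC scaleR_add_right scaleC_scaleR)+
  have "\<exists>h. \<forall>v. cinner (Q (G v)) y = cinner v h"
  proof (rule Riesz_representation)
    show "cinner (Q (G (v + w))) y = cinner (Q (G v)) y + cinner (Q (G w)) y" for v w
      using clinear_onD(1)[OF lin G_H(1) G_H(1)] by (simp add: G_add cinner_add_left)
    show "cinner (Q (G (a *\<^sub>C v))) y = a * cinner (Q (G v)) y" for a v
      using clinear_onD(2)[OF lin G_H(1)] by (simp add: G_scale cinner_scaleC_left)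
    show "cmod (cinner (Q (G v)) y) \<le> (\<bar>K\<bar> * l * norm y) * norm v" for v
      using order_trans[OF Cauchy_Schwarz_cinner mult_right_mono[OF G_H(2)[of v], of "norm y"]]
      by (simp add: mult_ac)
  qed
  then obtain h where "\<And>v. cinner (Q (G v)) y = cinner v h" by blast
  then have h: "cinner h v = cinner y (Q (G v))" for v by (metis cinner_commute)
  have "fcalc_dual E g (Q_adj Q y) = h"
    unfolding fcalc_dual_def Q_adj_def G_def[symmetric]
    by (rule the_equality) (use h in \<open>auto intro: cinner_eqI\<close>)
  then show ?thesis using h by (simp add: G_def)
qed

text \<open>Since \<open>(P + l\<^sup>2) z = - \<i> l Q\<^sup>* Q u\<close>, subtracting \<open>z\<close> from the first component of \<open>(u, - \<i> l u)\<close>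
  cancels the part of \<open>Q\<^sup>* Q u\<close> outside \<open>H\<close>.\<close>

lemma eigenvector_quasimode:
  fixes Q :: "'a \<Rightarrow> 'b::complex_hilbert"
  assumes Q: "bounded_observation E Q" and l: "1 \<le> l"
    and u: "jump l u = u"
  defines "h \<equiv> fcalc_dual E (\<lambda>x. (1 + x / l\<^sup>2) powr (- 1 / 2)) (Q_adj Q (Q u))"
  obtains U where "U \<in> generator_dom E Q" "l * norm u \<le> energy_norm E U"
    "shifted_generator E Q (\<i> * complex_of_real l) U \<in> energy_space E"
    "energy_norm E (shifted_generator E Q (\<i> * complex_of_real l) U) \<le> 2 * l * norm h"
proof -
  have lin: "clinear_on (H_half E) Q" using Q unfolding bounded_observation_def by blast
  have l0: "0 < l" using l by simp
  have s_pos: "0 < sqrt (l\<^sup>2 + r\<^sup>2)" for r using l0 by (simp add: add_pos_nonneg)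
  have ju: "jump r u = (if r = l then u else 0)" for r
    using jump_jump[of r l u] by (auto simp: u)
  have uH: "u \<in> H_half E" using jump_in_H_half[of l u] by (simp add: u)
  have c1: "\<bar>1 / sqrt (l\<^sup>2 + r\<^sup>2)\<bar> \<le> 1 / l" for r
  proof -
    have "sqrt (l\<^sup>2) \<le> sqrt (l\<^sup>2 + r\<^sup>2)" by (intro real_sqrt_le_mono) simp
    then show ?thesis using l0 by (simp add: frac_le)
  qed
  \<comment> \<open>\<open>z0\<close> is \<open>(P + l\<^sup>2)^(-1/2) h\<close>; the vector
    \<open>z1\<close> below is \<open>(1 + P)^(1/2) z0\<close>, whose norm is the
    \<open>H_half\<close> norm of \<open>z0\<close>.\<close>
  obtain z0 where z0: "\<And>r. jump r z0 = (1 / sqrt (l\<^sup>2 + r\<^sup>2)) *\<^sub>R jump r h"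
    using exists_bounded_multiplier[of "\<lambda>r. 1 / sqrt (l\<^sup>2 + r\<^sup>2)", OF c1] by blast
  have c2: "\<bar>sqrt (1 + r\<^sup>2) * (1 / sqrt (l\<^sup>2 + r\<^sup>2))\<bar> \<le> 1" for r
  proof -
    have "sqrt (1 + r\<^sup>2) \<le> sqrt (l\<^sup>2 + r\<^sup>2)" using l by (intro real_sqrt_le_mono) simp
    then show ?thesis using s_pos[of r] by (simp add: abs_mult)
  qed
  obtain z1 where z1: "\<And>r. jump r z1 = (sqrt (1 + r\<^sup>2) * (1 / sqrt (l\<^sup>2 + r\<^sup>2))) *\<^sub>R jump r h"
    using exists_bounded_multiplier[of "\<lambda>r. sqrt (1 + r\<^sup>2) * (1 / sqrt (l\<^sup>2 + r\<^sup>2))", OF c2] by blast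
  have z1': "jump r z1 = sqrt (1 + r\<^sup>2) *\<^sub>R jump r z0" for r by (simp add: z1 z0)
  have norm_z0: "l * norm z0 \<le> norm h"
    using norm_multiplier_le[OF z0 c1] l0 by (simp add: field_simps)
  have norm_z1: "norm z1 \<le> norm h" using norm_multiplier_le[OF z1 c2] by simp
  define z where "z = (- \<i>) *\<^sub>C z0"
  have jz: "jump r z = (- \<i>) *\<^sub>C (1 / sqrt (l\<^sup>2 + r\<^sup>2)) *\<^sub>R jump r h" for r
    by (simp only: z_def jump_scaleC z0)
  have z0H: "z0 \<in> H_half E" unfolding H_half_iff using z1' by blast
  then have zH: "z \<in> H_half E" unfolding z_def by (rule clinear_onD(5)[OF lin])
  have uzH: "u - z \<in> H_half E"
    using clinear_onD(4)[OF lin uH clinear_onD(5)[OF lin zH, of "-1"]] by (simp add: scaleC_minus_one)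
  define il where "il = \<i> * complex_of_real l"
  define v where "v = (- il) *\<^sub>C u"
  have vH: "v \<in> H_half E" unfolding v_def by (rule clinear_onD(5)[OF lin uH])
  \<comment> \<open>The value of \<open>P (u - z) + Q_adj Q (Q v)\<close>, from
    \<open>P u = l\<^sup>2 u\<close> and \<open>(P + l\<^sup>2) z = Q_adj Q (Q v)\<close>.\<close>
  define k where "k = l\<^sup>2 *\<^sub>R (u + z)"
  have rep: "represents E (\<lambda>w. P_ext E (u - z) w + Q_adj Q (Q v) w) k"
    unfolding represents_def
  proof
    fix w assume w: "w \<in> H_half E"
    obtain w1 where w1: "\<And>r. jump r w1 = sqrt (1 + r\<^sup>2) *\<^sub>R jump r w"
      using H_halfE[OF w] by blast
    have c3: "\<bar>sqrt (l\<^sup>2 + r\<^sup>2) / l / sqrt (1 + r\<^sup>2)\<bar> \<le> 1" for r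
    proof -
      have "sqrt (l\<^sup>2 + r\<^sup>2) \<le> sqrt (l\<^sup>2 * (1 + r\<^sup>2))"
        using l mult_right_mono[of 1 "l\<^sup>2" "r\<^sup>2"] by (intro real_sqrt_le_mono) (simp add: algebra_simps)
      also have "\<dots> = l * sqrt (1 + r\<^sup>2)" using l0 by (simp add: real_sqrt_mult)
      finally show ?thesis using l0 one_plus_sq_pos[of r] by (simp add: divide_le_eq)
    qed
    \<comment> \<open>\<open>x\<close> is \<open>(1 + P / l\<^sup>2)^(1/2) w\<close>, a vector of
      \<open>H\<close> since \<open>w\<close> lies in \<open>H_half E\<close>. Undoing this power
      recovers \<open>w\<close>, so \<open>cinner (Q u) (Q w)\<close> becomes
      \<open>cinner h x\<close>.\<close>
    obtain x where "\<And>r. jump r x = (sqrt (l\<^sup>2 + r\<^sup>2) / l / sqrt (1 + r\<^sup>2)) *\<^sub>R jump r w1"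
      using exists_bounded_multiplier[of "\<lambda>r. sqrt (l\<^sup>2 + r\<^sup>2) / l / sqrt (1 + r\<^sup>2)", OF c3] by blast
    then have x: "jump r x = (sqrt (l\<^sup>2 + r\<^sup>2) / l) *\<^sub>R jump r w" for r
      by (simp add: w1)
    have "fcalc E (\<lambda>x. (1 + x / l\<^sup>2) powr (- 1 / 2)) x = w"
    proof (rule jump_eqI)
      show "jump r (fcalc E (\<lambda>x. (1 + x / l\<^sup>2) powr (- 1 / 2)) x) = jump r w" for r
        unfolding fcalc_resolvent_half[OF l0] x using s_pos[of r] l0 by simp
    qed
    then have hx: "cinner (Q u) (Q w) = cinner h x"
      unfolding h_def fcalc_dual_Q_adj[OF Q l] by (simp only:)
    \<comment> \<open>The identity holds jump by jump: \<open>u\<close> lives at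
      \<open>r = l\<close>, and the factor \<open>1 / s\<close> in \<open>z\<close> matches the
      factor \<open>s / l\<close> in \<open>x\<close> because
      \<open>s * s = l\<^sup>2 + r\<^sup>2\<close>.\<close>
    have pointwise: "r\<^sup>2 *\<^sub>R cinner (jump r (u - z)) (jump r w)
        = complex_of_real (l\<^sup>2) * cinner (jump r (u + z)) (jump r w) + il * cinner (jump r h) (jump r x)" for r
    proof -
      define s where "s = sqrt (l\<^sup>2 + r\<^sup>2)"
      define b where "b = cinner (jump r h) (jump r w)"
      have s: "0 < s" "s * s = l\<^sup>2 + r\<^sup>2" using s_pos by (auto simp: s_def)
      have 1: "r\<^sup>2 *\<^sub>R cinner (jump r u) (jump r w) = l\<^sup>2 *\<^sub>R cinner (jump r u) (jump r w)"
        by (simp add: ju)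
      have 2: "cinner (jump r z) (jump r w) = - \<i> * complex_of_real (1 / s) * b"
        unfolding jz cinner_scaleC_left cinner_scaleR_left s_def b_def scaleR_conv_of_real by simp
      have 3: "cinner (jump r h) (jump r x) = complex_of_real (s / l) * b"
        by (simp add: x cinner_scaleR_right s_def b_def scaleR_conv_of_real)
      have "(l\<^sup>2 + r\<^sup>2) * (1 / s) = l * (s / l)" using s l0 by (simp add: field_simps)
      then have 4: "complex_of_real (l\<^sup>2 + r\<^sup>2) * complex_of_real (1 / s)
          = complex_of_real l * complex_of_real (s / l)"
        by (simp only: of_real_mult[symmetric])
      have "complex_of_real (r\<^sup>2) * (- (- \<i> * complex_of_real (1 / s) * b))
        = complex_of_real (l\<^sup>2) * (- \<i> * complex_of_real (1 / s) * b)
          + \<i> * b * (complex_of_real (l\<^sup>2 + r\<^sup>2) * complex_of_real (1 / s))"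
        by (simp add: algebra_simps)
      also have "\<dots> = complex_of_real (l\<^sup>2) * (- \<i> * complex_of_real (1 / s) * b)
          + il * (complex_of_real (s / l) * b)"
        unfolding 4 by (simp add: il_def)
      finally have 5: "complex_of_real (r\<^sup>2) * (- cinner (jump r z) (jump r w))
        = complex_of_real (l\<^sup>2) * cinner (jump r z) (jump r w) + il * cinner (jump r h) (jump r x)"
        unfolding 2 3 .
      have "r\<^sup>2 *\<^sub>R cinner (jump r (u - z)) (jump r w) = r\<^sup>2 *\<^sub>R cinner (jump r u) (jump r w)
          + complex_of_real (r\<^sup>2) * (- cinner (jump r z) (jump r w))"
        by (simp add: jump_diff cinner.diff_left scaleR_conv_of_real algebra_simps del: of_real_power)
      also have "\<dots> = complex_of_real (l\<^sup>2) * cinner (jump r (u + z)) (jump r w)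
          + il * cinner (jump r h) (jump r x)"
        unfolding 1 5 by (simp add: jump_add cinner_add_left scaleR_conv_of_real algebra_simps
            del: of_real_power)
      finally show ?thesis .
    qed
    have "P_ext E (u - z) w = complex_of_real (l\<^sup>2) * cinner (u + z) w + il * cinner h x"
      unfolding P_ext_eq_sum(2)[OF uzH w] pointwise
      using integrable_cinner_jump by (simp add: integral_cinner_jump del: of_real_power)
    moreover have "Q_adj Q (Q v) w = - il * cinner h x"
    proof -
      have "Q v = (- il) *\<^sub>C Q u" unfolding v_def by (rule clinear_onD(2)[OF lin uH])
      then show ?thesis by (simp only: Q_adj_def cinner_scaleC_left hx)
    qed
    ultimately show "P_ext E (u - z) w + Q_adj Q (Q v) w = cinner k w"
      by (simp add: k_def cinner_scaleR_left scaleR_conv_of_real del: of_real_power)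
  qed
  have the: "(THE h. represents E (\<lambda>w. P_ext E (u - z) w + Q_adj Q (Q v) w) h) = k"
  proof (rule the_equality[of "represents E (\<lambda>w. P_ext E (u - z) w + Q_adj Q (Q v) w)", OF rep])
    show "h' = k" if "represents E (\<lambda>w. P_ext E (u - z) w + Q_adj Q (Q v) w) h'" for h'
      using that rep unfolding represents_def by (intro H_half_separating) simp
  qed
  define U where "U = (u - z, v)"
  \<comment> \<open>As \<open>z = (- \<i>) *\<^sub>C z0\<close>, this is the pair of
    \<open>- \<i> l z\<close> and \<open>- l\<^sup>2 z\<close>; all terms in \<open>u\<close> have
    cancelled.\<close>
  define F where "F = (- l *\<^sub>R z0, l\<^sup>2 *\<^sub>R \<i> *\<^sub>C z0)"
  have gen: "shifted_generator E Q il U = F"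
  proof -
    have "v + il *\<^sub>C (u - z) = - l *\<^sub>R z0"
    proof -
      have "il *\<^sub>C z = l *\<^sub>R z0"
      proof -
        have "il * (- \<i>) = complex_of_real l" by (simp add: il_def complex_eq_iff)
        then show ?thesis by (simp only: z_def scaleC_scaleC scaleC_of_real)
      qed
      then show ?thesis by (simp add: v_def scaleC.diff_right scaleC.minus_left)
    qed
    moreover have "- k + il *\<^sub>C v = l\<^sup>2 *\<^sub>R \<i> *\<^sub>C z0"
    proof -
      have "il *\<^sub>C v = l\<^sup>2 *\<^sub>R u"
      proof -
        have "il * (- il) = complex_of_real (l\<^sup>2)" by (simp add: il_def power2_eq_square complex_eq_iff)
        then show ?thesis by (simp only: v_def scaleC_scaleC scaleC_of_real)
      qed
      then show ?thesis by (simp add: k_def scaleR_add_right scaleR_diff_right z_def scaleC.minus_left)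
    qed
    ultimately show ?thesis
      by (simp add: shifted_generator_def generator_def U_def F_def the)
  qed
  have "U \<in> generator_dom E Q"
    using uzH vH rep unfolding generator_dom_def U_def by auto
  moreover have "l * norm u \<le> energy_norm E U"
  proof -
    have "norm v = l * norm u" using l0 by (simp add: v_def il_def norm_scaleC norm_mult)
    then show ?thesis unfolding energy_norm_def U_def
      by (intro real_le_rsqrt) simp
  qed
  moreover have "shifted_generator E Q il U \<in> energy_space E"
    unfolding gen F_def energy_space_def
    using clinear_onD(5)[OF lin z0H, of "complex_of_real (- l)"] scaleC_of_real[of "- l" z0] by simp
  moreover have "energy_norm E (shifted_generator E Q il U) \<le> 2 * l * norm h"
  proof -
    have "jump r ((- l) *\<^sub>R z1) = sqrt (1 + r\<^sup>2) *\<^sub>R jump r ((- l) *\<^sub>R z0)" for r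
      unfolding jump_scaleR z1' by simp
    then have "sobolev_norm E (1/2) ((- l) *\<^sub>R z0) = l * norm z1"
      using sobolev_norm_half_eq[of "(- l) *\<^sub>R z1" "(- l) *\<^sub>R z0"] l0 by simp
    moreover have "norm (l\<^sup>2 *\<^sub>R \<i> *\<^sub>C z0) = l * (l * norm z0)"
      using l0 by (simp add: norm_scaleC power2_eq_square)
    ultimately have "energy_norm E F = sqrt ((l * norm z1)\<^sup>2 + (l * (l * norm z0))\<^sup>2)"
      unfolding energy_norm_def F_def by simp
    also have "\<dots> \<le> l * norm z1 + l * (l * norm z0)"
      using l0 by (intro sqrt_sum_squares_le_sum) auto
    also have "\<dots> \<le> l * norm h + l * norm h"
      using norm_z0 norm_z1 l0 by (intro add_mono mult_left_mono) auto
    finally show ?thesis unfolding gen by simp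
  qed
  ultimately show ?thesis using that unfolding il_def by blast
qed

text \<open>A bounded inverse sends the image of \<open>U\<close> back to \<open>U\<close>, so that
  image competes in the supremum; without a bounded inverse the norm is infinite by
  convention.\<close>

lemma resolvent_norm_ge:
  assumes "U \<in> generator_dom E Q" "shifted_generator E Q z U \<in> energy_space E"
    "energy_norm E (shifted_generator E Q z U) \<le> 1"
  shows "ennreal (energy_norm E U) \<le> resolvent_norm E Q z"
proof (cases "boundedly_invertible E Q z")
  case True
  then have "inv_into (generator_dom E Q) (shifted_generator E Q z) (shifted_generator E Q z U) = U"
    using assms(1) unfolding boundedly_invertible_def by (auto dest: bij_betw_inv_into_left)
  then show ?thesis
    unfolding resolvent_norm_def using True assms(2,3)
    by (auto intro!: SUP_upper2[of "shifted_generator E Q z U"])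
qed (simp add: resolvent_norm_def)

end

text \<open>Unit vectors in the range of \<open>E R\<close> have images under \<open>P\<close> of
  norm at most \<open>2 * R\<^sup>2\<close>, so the compact resolvent yields a convergent
  subsequence.\<close>

lemma compact_spectral_famI:
  assumes "self_adjoint D P" "compact_resolvent D P" "spectral_resolution D P E"
  shows "compact_spectral_fam E"
proof -
  have fam: "spectral_family E" and D: "D = fdom E (\<lambda>x. x)"
    and P: "\<And>u. u \<in> D \<Longrightarrow> P u = fcalc E (\<lambda>x. x) u"
    using assms(3) unfolding spectral_resolution_def by auto
  interpret spectral_fam E by standard (rule fam)
  have dense: "closure (fdom E (\<lambda>x. x)) = UNIV"
    using assms(1) D unfolding self_adjoint_def by simp
  show ?thesis
  proof
    fix R and u :: "nat \<Rightarrow> 'a"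
    assume u: "\<And>n. E R (u n) = u n" "\<And>n. norm (u n) = 1"
    have "0 \<le> R" using E_neg[of R "u 0"] u(1)[of 0] u(2)[of 0] by force
    have "u n \<in> D" for n using fdom_id_cutoff[OF u(1)] D by simp
    moreover have "norm (P (u n)) \<le> 2 * R\<^sup>2" for n
      using norm_fcalc_id_cutoff[OF u(1) \<open>0 \<le> R\<close> dense, of n] P[of "u n"] u(2)[of n]
        \<open>u n \<in> D\<close> by simp
    ultimately show "\<exists>l r. strict_mono (r :: nat \<Rightarrow> nat) \<and> (\<lambda>n. u (r n)) \<longlonglongrightarrow> l"
      using compact_resolvent_convergent_subseq[OF assms(2), of u 1 "2 * R\<^sup>2"] u(2) by auto
  qed
qed

theorem theorem1p7:
  fixes D :: "'a::complex_hilbert set"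
    and P :: "'a \<Rightarrow> 'a"
    and E :: "real \<Rightarrow> 'a \<Rightarrow> 'a"
    and Q :: "'a \<Rightarrow> 'b::complex_hilbert"
    and m :: "real \<Rightarrow> real"
  assumes "infinite_dimensional TYPE('a)"
    and "self_adjoint D P" and "nonnegative_operator D P" and "compact_resolvent D P"
    and "spectral_resolution D P E"
    and "bounded_observation E Q"
    and "continuous_on {0<..} m" and "\<And>x. x > 0 \<Longrightarrow> m x > 0"
    and "m_bounded E Q m"
  shows "\<exists>(l :: nat \<Rightarrow> real) C. filterlim l at_top sequentially \<and> C > 0 \<and>
    (\<forall>k. l k \<noteq> 0 \<and>
      ennreal (1 / (C * m \<bar>l k\<bar>)) \<le> resolvent_norm E Q (\<i> * complex_of_real (l k)))"
proof -
  interpret compact_spectral_fam E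
    by (rule compact_spectral_famI) (rule assms)+
  have lin: "clinear_on (H_half E) Q" using assms(6) unfolding bounded_observation_def by blast
  obtain chi C where chi: "chi 1 > (0 :: real)" and C: "C > 0"
    and bound: "\<And>u l. u \<in> H_half E \<Longrightarrow> l \<ge> C \<Longrightarrow>
       u \<in> fdom E (\<lambda>x. chi (x / l\<^sup>2)) \<and>
       norm (fcalc_dual E (\<lambda>x. (1 + x / l\<^sup>2) powr (-1/2))
               (Q_adj Q (Q (fcalc E (\<lambda>x. chi (x / l\<^sup>2)) u))))
         \<le> C * m l * norm (fcalc E (\<lambda>x. (1 + x / l\<^sup>2) powr (1/2)) u)"
    using assms(9) unfolding m_bounded_def by blast
  \<comment> \<open>On the eigenspace for \<open>l\<^sup>2\<close> the operator
    \<open>(1 + P / l\<^sup>2)^(1/2)\<close> acts as \<open>sqrt 2\<close> and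
    \<open>chi (P / l\<^sup>2)\<close> as \<open>chi 1\<close>.\<close>
  define B where "B = C * sqrt 2 / chi 1"
  have "B > 0" using chi C by (simp add: B_def)
  have main: "ennreal (1 / (2 * B * m l)) \<le> resolvent_norm E Q (\<i> * complex_of_real l)"
    if l: "l \<ge> 1" "l \<ge> C" and ev: "jump l w \<noteq> 0" for l w
  proof -
    have ml: "m l > 0" using assms(8) l by simp
    \<comment> \<open>Scaled so that \<open>2 * l * (B * m l * norm u) = 1\<close>: the image of the
      quasimode then lies in the unit ball, while its own norm is at least
      \<open>l * norm u = 1 / (2 * B * m l)\<close>.\<close>
    define t where "t = 1 / (2 * l * B * m l) / norm (jump l w)"
    define u where "u = t *\<^sub>R jump l w"
    have norm_u: "norm u = 1 / (2 * l * B * m l)"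
      using ev \<open>B > 0\<close> ml l by (simp add: u_def t_def)
    have u: "jump l u = u" by (simp add: u_def jump_scaleR jump_jump)
    have ju: "jump r u = (if r = l then u else 0)" for r
      using jump_jump[of r l u] by (auto simp: u)
    \<comment> \<open>The preimage of \<open>u\<close> under \<open>chi (P / l\<^sup>2)\<close>, so
      that \<open>bound\<close> at \<open>x\<close> estimates the term with
      \<open>Q u\<close>.\<close>
    define x where "x = (1 / chi 1) *\<^sub>R u"
    have jx: "jump r x = (if r = l then x else 0)" for r
      by (simp add: x_def jump_scaleR ju)
    have xH: "x \<in> H_half E" using jump_in_H_half[of l x] by (simp add: jx)
    have x: "x \<in> fdom E (\<lambda>x. chi (x / l\<^sup>2))" using bound[OF xH l(2)] by blast
    have "jump r (fcalc E (\<lambda>x. chi (x / l\<^sup>2)) x) = jump r u" for r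
      unfolding jump_fcalc[OF x] jx ju using l chi by (simp add: x_def)
    then have "fcalc E (\<lambda>x. chi (x / l\<^sup>2)) x = u" by (rule jump_eqI)
    moreover have "fcalc E (\<lambda>x. (1 + x / l\<^sup>2) powr (1/2)) x = sqrt 2 *\<^sub>R x"
    proof (rule fcalc_eqI)
      show "jump r (sqrt 2 *\<^sub>R x) = ((1 + r\<^sup>2 / l\<^sup>2) powr (1 / 2)) *\<^sub>R jump r x" for r
        unfolding jump_scaleR jx using l by (simp add: powr_half_sqrt)
    qed measurable
    ultimately have "norm (fcalc_dual E (\<lambda>x. (1 + x / l\<^sup>2) powr (-1/2)) (Q_adj Q (Q u)))
        \<le> C * m l * (sqrt 2 * norm x)"
      using bound[OF xH l(2)] by simp
    also have "\<dots> = B * m l * norm u" using chi by (simp add: B_def x_def)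
    finally have h: "norm (fcalc_dual E (\<lambda>x. (1 + x / l\<^sup>2) powr (-1/2)) (Q_adj Q (Q u)))
        \<le> B * m l * norm u" .
    obtain U where U: "U \<in> generator_dom E Q" "l * norm u \<le> energy_norm E U"
      "shifted_generator E Q (\<i> * complex_of_real l) U \<in> energy_space E"
      "energy_norm E (shifted_generator E Q (\<i> * complex_of_real l) U)
        \<le> 2 * l * norm (fcalc_dual E (\<lambda>x. (1 + x / l\<^sup>2) powr (-1/2)) (Q_adj Q (Q u)))"
      using eigenvector_quasimode[OF assms(6) l(1) u] by blast
    have "2 * l * (B * m l * norm u) = 1"
      using \<open>B > 0\<close> ml l by (simp add: norm_u)
    then have "energy_norm E (shifted_generator E Q (\<i> * complex_of_real l) U) \<le> 1"
      using order_trans[OF U(4) mult_left_mono[OF h, of "2 * l"]] l by simp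
    then have "ennreal (energy_norm E U) \<le> resolvent_norm E Q (\<i> * complex_of_real l)"
      using U by (intro resolvent_norm_ge)
    moreover have "1 / (2 * B * m l) = l * norm u"
      using l by (simp add: norm_u)
    ultimately show ?thesis
      using order_trans[OF ennreal_leI[OF U(2)]] by simp
  qed
  \<comment> \<open>The three thresholds serve the quasimode (\<open>1\<close>), the estimate from
    \<open>m_bounded\<close> (\<open>C\<close>) and divergence of the sequence
    (\<open>k\<close>).\<close>
  have "\<exists>l>max (max 1 C) (real k). \<exists>w. jump l w \<noteq> 0" for k
    by (rule jumps_unbounded[OF assms(1)])
  then obtain l w where l: "\<And>k. l k > max (max 1 C) (real k)" "\<And>k. jump (l k) (w k) \<noteq> 0"
    by metis
  have "filterlim l at_top sequentially"
    by (rule filterlim_at_top_mono[OF filterlim_real_sequentially])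
       (use l(1) in \<open>auto intro!: always_eventually less_imp_le\<close>)
  moreover have "l k \<noteq> 0 \<and>
      ennreal (1 / (2 * B * m \<bar>l k\<bar>)) \<le> resolvent_norm E Q (\<i> * complex_of_real (l k))" for k
    using main[of "l k" "w k"] l(1)[of k] l(2)[of k] by simp
  ultimately show ?thesis using \<open>B > 0\<close> by (intro exI[of _ l] exI[of _ "2 * B"]) simp
qed

end
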